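(* Let $p\ge 2$ be an integer, let $\zeta\in\mathbb C$ be a primitive $p$-th root of unity, and let $\mathfrak u,\mathfrak v\in M_p(\mathbb C)$ be the Weyl unitary matrices. Then the Weyl pair $(\mathfrak u,\mathfrak v)$ is an absolute extreme point of its matrix range $W(\mathfrak u,\mathfrak v)$.
   Context: $M_n(\mathbb C)$ is the algebra of complex $n\times n$ matrices with identity $1_n$. The Weyl unitary matrices (with respect to $p$ and $\zeta$) are $\mathfrak u=\mathrm{diag}(1,\zeta,\zeta^2,\dots,\zeta^{p-1})$ and the cyclic shift $\mathfrak v$, whose $(1,p)$-entry and $(k,k-1)$-entries ($2\le k\le p$) are $1$ and whose other entries are $0$. For a $g$-tuple $z=(z_1,\dots,z_g)$ of complex $d\times d$ matrices, $\mathcal O_z=\mathrm{Span}_{\mathbb C}\{1_d,z_k,z_k^*\mid k=1,\dots,g\}$, and the matrix range of $z$ is the sequence $W(z)=(W^n(z))_{n\in\mathbb N}$, where $W^n(z)\subseteq M_n(\mathbb C)^g$ is the set of all tuples $(\psi(z_1),\dots,\psi(z_g))$ with $\psi:\mathcal O_z\to M_n(\mathbb C)$ a unital completely positive linear map. For a $g$-tuple $a=(a_1,\dots,a_g)$ of $d\times d$ matrices and a linear map $\gamma:\mathbb C^n\to\mathbb C^d$, write $\gamma^*a\gamma=(\gamma^*a_1\gamma,\dots,\gamma^*a_g\gamma)$. For $g$-tuples $a,b$ of matrices of the same size, $a\simeq_{\rm u}b$ means $b=\gamma^*a\gamma$ for some unitary $\gamma$. Direct sums $b\oplus c$ of $g$-tuples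 are taken entrywise. A sequence $K=(K_n)_{n\in\mathbb N}$ with $K_n\subseteq M_n(\mathbb C)^g$ is matrix convex if $\sum_{j=1}^m\gamma_j^*a_j\gamma_j\in K_n$ for all $m\in\mathbb N$, all $a_j\in K_{n_j}$ and all linear maps $\gamma_j:\mathbb C^n\to\mathbb C^{n_j}$ with $\sum_{j=1}^m\gamma_j^*\gamma_j=1_n$; such $\gamma_j$ are called matrix convex coefficients and such a sum is a matrix convex combination of the $a_j$. (Matrix ranges are matrix convex.) If $K=(K_n)_n$ is matrix convex, an element $b\in K_n$ is an absolute extreme point of $K$ if, whenever $b=\sum_{j=1}^m\gamma_j^*a_j\gamma_j$ is a matrix convex combination of elements $a_j\in K_{n_j}$ such that each matrix convex coefficient $\gamma_j$ is nonzero, then, for each $j$, either (i) $n_j=n$ and $a_j\simeq_{\rm u}b$, or (ii) $n_j>n$ and there exists a $g$-tuple $c_j$ of matrices such that $a_j\simeq_{\rm u}b\oplus c_j$. *)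

theory Defs
  imports "Jordan_Normal_Form.Schur_Decomposition" "Jordan_Normal_Form.VS_Connect"
begin

(* Matrix sizes vary inside the definitions, so matrices are the dimension-carrying type of
   Jordan_Normal_Form, and M_n(C) is carrier_mat n n. A linear map C^n -> C^k is a matrix in
   carrier_mat k n. The adjoint is mat_adjoint. Indices start at 0. *)

type_synonym mtuple = "complex mat list"

definition mtuples :: "nat \<Rightarrow> nat \<Rightarrow> mtuple set" where
  "mtuples g n = {a. length a = g \<and> set a \<subseteq> carrier_mat n n}"

(* Discharges the locale premise (module) under which span_def and lincomb_def apply. *)
lemma module_module_mat:
  "Module.module class_ring (module_mat TYPE('a :: comm_ring_1) nr nc)"
proof -
  interpret abelian_group "module_mat TYPE('a) nr nc" by (rule abelian_group_mat)
  show ?thesis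
    by (intro_locales, unfold_locales)
      (auto simp: module_mat_simps class_ring_simps add_smult_distrib_right_mat
        add_smult_distrib_left_mat mult_smult_assoc_mat)
qed

abbreviation mat_sum :: "nat \<Rightarrow> (nat \<Rightarrow> complex mat) \<Rightarrow> nat \<Rightarrow> complex mat" where
  "mat_sum n f m \<equiv> finsum (module_mat TYPE(complex) n n) f {..<m}"

definition unitary :: "nat \<Rightarrow> complex mat \<Rightarrow> bool" where
  "unitary n U \<longleftrightarrow> U \<in> carrier_mat n n \<and> mat_adjoint U * U = 1\<^sub>m n \<and> U * mat_adjoint U = 1\<^sub>m n"

(* The order on complex numbers is the one of Complex_Order: 0 \<le> z says that z is real and
   nonnegative. *)
definition pos_semidef :: "nat \<Rightarrow> complex mat \<Rightarrow> bool" where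
  "pos_semidef n A \<longleftrightarrow> A \<in> carrier_mat n n \<and> (\<forall>x \<in> carrier_vec n. 0 \<le> (A *\<^sub>v x) \<bullet>c x)"

(* The element [X i j] of M_k(M_n(C)) as a matrix of size k * n. *)
definition block_mat :: "nat \<Rightarrow> nat \<Rightarrow> (nat \<Rightarrow> nat \<Rightarrow> complex mat) \<Rightarrow> complex mat" where
  "block_mat k n X =
     mat (k * n) (k * n) (\<lambda>(r, s). X (r div n) (s div n) $$ (r mod n, s mod n))"

definition op_system :: "nat \<Rightarrow> mtuple \<Rightarrow> complex mat set" where
  "op_system d z =
     LinearCombinations.module.span class_ring (module_mat TYPE(complex) d d)
       (insert (1\<^sub>m d) (set z \<union> mat_adjoint ` set z))"

(* Unital completely positive linear maps S -> M_n(C) for a subspace S of M_d(C); the values of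
   psi outside S are irrelevant. *)
definition ucp_map ::
  "nat \<Rightarrow> complex mat set \<Rightarrow> nat \<Rightarrow> (complex mat \<Rightarrow> complex mat) \<Rightarrow> bool" where
  "ucp_map d S n \<psi> \<longleftrightarrow>
     \<psi> \<in> S \<rightarrow> carrier_mat n n \<and>
     (\<forall>x \<in> S. \<forall>y \<in> S. \<psi> (x + y) = \<psi> x + \<psi> y) \<and>
     (\<forall>c. \<forall>x \<in> S. \<psi> (c \<cdot>\<^sub>m x) = c \<cdot>\<^sub>m \<psi> x) \<and>
     \<psi> (1\<^sub>m d) = 1\<^sub>m n \<and>
     (\<forall>k > 0. \<forall>X. (\<forall>i < k. \<forall>j < k. X i j \<in> S) \<and> pos_semidef (k * d) (block_mat k d X) \<longrightarrow>
        pos_semidef (k * n) (block_mat k n (\<lambda>i j. \<psi> (X i j))))"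

(* A sequence of sets of tuples is a function on nat of which only the levels n > 0 matter. *)
definition matrix_range :: "nat \<Rightarrow> mtuple \<Rightarrow> nat \<Rightarrow> mtuple set" where
  "matrix_range d z n = {map \<psi> z | \<psi>. ucp_map d (op_system d z) n \<psi>}"

definition compress :: "complex mat \<Rightarrow> mtuple \<Rightarrow> mtuple" where
  "compress \<gamma> a = map (\<lambda>x. mat_adjoint \<gamma> * x * \<gamma>) a"

definition unitarily_equiv :: "nat \<Rightarrow> mtuple \<Rightarrow> mtuple \<Rightarrow> bool" where
  "unitarily_equiv n a b \<longleftrightarrow> (\<exists>\<gamma>. unitary n \<gamma> \<and> b = compress \<gamma> a)"

definition tuple_dsum :: "mtuple \<Rightarrow> mtuple \<Rightarrow> mtuple" where
  "tuple_dsum b c = map2 (\<lambda>x y. diag_block_mat [x, y]) b c"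

definition convex_coeffs ::
  "nat \<Rightarrow> nat \<Rightarrow> (nat \<Rightarrow> nat) \<Rightarrow> (nat \<Rightarrow> complex mat) \<Rightarrow> bool" where
  "convex_coeffs n m N \<gamma> \<longleftrightarrow>
     (\<forall>j < m. \<gamma> j \<in> carrier_mat (N j) n) \<and>
     mat_sum n (\<lambda>j. mat_adjoint (\<gamma> j) * \<gamma> j) m = 1\<^sub>m n"

definition matrix_comb ::
  "nat \<Rightarrow> nat \<Rightarrow> nat \<Rightarrow> (nat \<Rightarrow> mtuple) \<Rightarrow> (nat \<Rightarrow> complex mat) \<Rightarrow> mtuple" where
  "matrix_comb g n m a \<gamma> = map (\<lambda>i. mat_sum n (\<lambda>j. compress (\<gamma> j) (a j) ! i) m) [0..<g]"

definition matrix_convex :: "nat \<Rightarrow> (nat \<Rightarrow> mtuple set) \<Rightarrow> bool" where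
  "matrix_convex g K \<longleftrightarrow>
     (\<forall>n > 0. K n \<subseteq> mtuples g n) \<and>
     (\<forall>n > 0. \<forall>m > 0. \<forall>N a \<gamma>.
        (\<forall>j < m. N j > 0 \<and> a j \<in> K (N j)) \<and> convex_coeffs n m N \<gamma> \<longrightarrow>
        matrix_comb g n m a \<gamma> \<in> K n)"

definition absolute_extreme_point ::
  "nat \<Rightarrow> (nat \<Rightarrow> mtuple set) \<Rightarrow> nat \<Rightarrow> mtuple \<Rightarrow> bool" where
  "absolute_extreme_point g K n b \<longleftrightarrow>
     matrix_convex g K \<and> n > 0 \<and> b \<in> K n \<and>
     (\<forall>m > 0. \<forall>N a \<gamma>.
        (\<forall>j < m. N j > 0 \<and> a j \<in> K (N j) \<and> \<gamma> j \<noteq> 0\<^sub>m (N j) n) \<and>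
        convex_coeffs n m N \<gamma> \<and> b = matrix_comb g n m a \<gamma> \<longrightarrow>
        (\<forall>j < m.
           N j = n \<and> unitarily_equiv n (a j) b \<or>
           N j > n \<and> (\<exists>c \<in> mtuples g (N j - n). unitarily_equiv (N j) (a j) (tuple_dsum b c))))"

definition weyl_u :: "nat \<Rightarrow> complex \<Rightarrow> complex mat" where
  "weyl_u p \<zeta> = mat_diag p (\<lambda>i. \<zeta> ^ i)"

definition weyl_v :: "nat \<Rightarrow> complex mat" where
  "weyl_v p = mat p p (\<lambda>(i, j). if i = 0 \<and> j = p - 1 \<or> i = j + 1 then 1 else 0)"

end

(* If U is unitary, the x_j are contractions and U is the matrix convex combination
   sum_j gamma_j^* x_j gamma_j, then x_j gamma_j = gamma_j U by an equality case of
   Cauchy-Schwarz. A unital completely positive map sends a unitary to a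
   contraction and respects adjoints, because [[1, U], [U^*, 1]] is positive semidefinite; so in
   a matrix convex combination representing a tuple b of unitaries with elements a_j of W(b), each
   gamma_j intertwines b with a_j and b^* with a_j^*. Hence gamma_j^* gamma_j commutes with b. If
   b is irreducible, as the Weyl pair is, then gamma_j is a positive multiple of an isometry whose
   range reduces a_j, and a_j restricts to b on this range up to unitary equivalence. *)

theory Submission
  imports Defs
begin

section \<open>Adjoints and inner products\<close>

text \<open>Write ' for the adjoint. The operator system of b is in general not closed under
  products, so multiplicativity of the maps is not at hand; the relation U'U = 1 reaches them only
  through matrices whose entries are 1, U and U'. Both U and U' have to be intertwined: outside the
  range of gamma_j, a_j is only known to be a contraction, so the relation for U makes that range
  invariant and the one for U' makes it reducing. With g = gamma_j and a = a_j, the two relations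
  give g'g U = g'a g = (a'g)'g = (g U')'g = U g'g. Irreducibility enters as triviality of the
  commutant and turns g'g into a scalar c at once; c > 0 because g is nonzero, and g / sqrt c is the
  isometry. Matrix convexity of the matrix range is part of being an absolute extreme point, so it
  is proved as well: compressing unital completely positive maps by matrix convex coefficients and
  summing gives such a map again.\<close>

lemma mat_adjoint_carrier [simp]:
  "A \<in> carrier_mat m n \<Longrightarrow> mat_adjoint A \<in> carrier_mat n m"
  unfolding mat_adjoint_def
  by (metis carrier_matD carrier_matI cols_length length_map mat_of_rows_carrier(2,3))

lemma dim_mat_adjoint [simp]:
  "dim_row (mat_adjoint A) = dim_col A" "dim_col (mat_adjoint A) = dim_row A"
  unfolding mat_adjoint_def by simp_all

lemma index_mat_adjoint [simp]:
  fixes A :: "complex mat"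
  shows "i < dim_col A \<Longrightarrow> j < dim_row A \<Longrightarrow> mat_adjoint A $$ (i, j) = cnj (A $$ (j, i))"
  unfolding mat_adjoint_def by (simp add: mat_of_rows_index)

lemma mat_adjoint_adjoint [simp]: "mat_adjoint (mat_adjoint A) = (A :: complex mat)"
  by (rule eq_matI) auto

lemma cscalar_prod_sum:
  fixes x y :: "complex vec"
  shows "y \<in> carrier_vec n \<Longrightarrow> x \<bullet>c y = (\<Sum>i<n. x $ i * cnj (y $ i))"
  by (auto simp: scalar_prod_def atLeast0LessThan)

lemma cnj_cscalar_prod:
  fixes x y :: "complex vec"
  shows "x \<in> carrier_vec n \<Longrightarrow> y \<in> carrier_vec n \<Longrightarrow> cnj (x \<bullet>c y) = y \<bullet>c x"
  by (simp add: cscalar_prod_sum mult.commute)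

lemma cscalar_prod_minus_right:
  fixes x y z :: "complex vec"
  shows "x \<in> carrier_vec n \<Longrightarrow> y \<in> carrier_vec n \<Longrightarrow> z \<in> carrier_vec n \<Longrightarrow>
    z \<bullet>c (x - y) = z \<bullet>c x - z \<bullet>c y"
  by (simp add: cscalar_prod_sum[of _ n] algebra_simps sum_subtractf)

lemma cscalar_prod_smult:
  fixes x y :: "complex vec"
  shows "x \<in> carrier_vec n \<Longrightarrow> y \<in> carrier_vec n \<Longrightarrow> (c \<cdot>\<^sub>v x) \<bullet>c y = c * (x \<bullet>c y)"
    "x \<in> carrier_vec n \<Longrightarrow> y \<in> carrier_vec n \<Longrightarrow> x \<bullet>c (c \<cdot>\<^sub>v y) = cnj c * (x \<bullet>c y)"
  by (simp_all add: cscalar_prod_sum sum_distrib_left algebra_simps)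

lemma cscalar_prod_mult_mat_vec:
  fixes A :: "complex mat"
  assumes "A \<in> carrier_mat m n" "x \<in> carrier_vec n" "y \<in> carrier_vec m"
  shows "(A *\<^sub>v x) \<bullet>c y = (\<Sum>i<m. \<Sum>j<n. A $$ (i, j) * x $ j * cnj (y $ i))"
  using assms
  by (auto simp: cscalar_prod_sum scalar_prod_def atLeast0LessThan sum_distrib_right intro!: sum.cong)

lemma cscalar_prod_adjoint:
  fixes A :: "complex mat"
  assumes "A \<in> carrier_mat m n" "x \<in> carrier_vec n" "y \<in> carrier_vec m"
  shows "(A *\<^sub>v x) \<bullet>c y = x \<bullet>c (mat_adjoint A *\<^sub>v y)"
proof -
  have "x \<bullet>c (mat_adjoint A *\<^sub>v y) = cnj ((mat_adjoint A *\<^sub>v y) \<bullet>c x)"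
    using assms by (intro cnj_cscalar_prod[symmetric] mult_mat_vec_carrier mat_adjoint_carrier)
  also have "\<dots> = (\<Sum>j<n. \<Sum>i<m. A $$ (i, j) * x $ j * cnj (y $ i))"
    using assms by (simp add: cscalar_prod_mult_mat_vec[of _ n m] mult.assoc mult.left_commute)
      (auto simp: mult_ac intro!: sum.cong)
  also have "\<dots> = (A *\<^sub>v x) \<bullet>c y"
    using assms by (subst sum.swap) (simp add: cscalar_prod_mult_mat_vec[of _ m n])
  finally show ?thesis by simp
qed

lemma cscalar_prod_adjoint':
  fixes A :: "complex mat"
  assumes "A \<in> carrier_mat m n" "x \<in> carrier_vec m" "y \<in> carrier_vec n"
  shows "(mat_adjoint A *\<^sub>v x) \<bullet>c y = x \<bullet>c (A *\<^sub>v y)"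
  using cscalar_prod_adjoint[of "mat_adjoint A" n m x y] assms by simp

lemma isometry_cscalar_prod:
  fixes U :: "complex mat"
  assumes "U \<in> carrier_mat n n" "mat_adjoint U * U = 1\<^sub>m n" "x \<in> carrier_vec n"
  shows "(U *\<^sub>v x) \<bullet>c (U *\<^sub>v x) = x \<bullet>c x"
proof -
  have "(U *\<^sub>v x) \<bullet>c (U *\<^sub>v x) = x \<bullet>c (mat_adjoint U * U *\<^sub>v x)"
    using assms(1,3) by (simp add: cscalar_prod_adjoint[of U n n] assoc_mult_mat_vec[of _ n n _ n])
  then show ?thesis using assms by simp
qed

lemma mat_adjoint_mult:
  fixes A B :: "complex mat"
  assumes "A \<in> carrier_mat m n" "B \<in> carrier_mat n k"
  shows "mat_adjoint (A * B) = mat_adjoint B * mat_adjoint A"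
  using assms by (intro eq_matI) (auto simp: scalar_prod_def mult.commute)

lemma mat_eqI_mult_vec:
  fixes A B :: "complex mat"
  assumes "A \<in> carrier_mat m n" "B \<in> carrier_mat m n"
    and "\<And>x. x \<in> carrier_vec n \<Longrightarrow> A *\<^sub>v x = B *\<^sub>v x"
  shows "A = B"
proof (rule eq_matI)
  fix i j assume ij: "i < dim_row B" "j < dim_col B"
  have "(A *\<^sub>v unit_vec n j) $ i = (B *\<^sub>v unit_vec n j) $ i"
    using assms(3) by simp
  then show "A $$ (i, j) = B $$ (i, j)"
    using assms(1,2) ij by simp
qed (use assms in auto)

text \<open>The test vector y = A x - B x does it. In this form, identities between sums of matrices
  reduce to identities between sums of numbers.\<close>

lemma mat_eqI_cscalar_prod:
  fixes A B :: "complex mat"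
  assumes "A \<in> carrier_mat m n" "B \<in> carrier_mat m n"
    and "\<And>x y. x \<in> carrier_vec n \<Longrightarrow> y \<in> carrier_vec m \<Longrightarrow> (A *\<^sub>v x) \<bullet>c y = (B *\<^sub>v x) \<bullet>c y"
  shows "A = B"
proof (rule mat_eqI_mult_vec[OF assms(1,2)])
  fix x :: "complex vec" assume x: "x \<in> carrier_vec n"
  let ?d = "A *\<^sub>v x - B *\<^sub>v x"
  have "?d \<bullet>c ?d = 0"
    using assms x by (subst minus_scalar_prod_distrib[of _ m]) auto
  then have "?d = 0\<^sub>v m"
    using assms x by (subst (asm) conjugate_square_eq_0_vec[of _ m]) auto
  then have "\<And>i. i < m \<Longrightarrow> ?d $ i = 0" by simp
  then show "A *\<^sub>v x = B *\<^sub>v x"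
    using assms(1,2) x by (intro eq_vecI) auto
qed

section \<open>Finite sums of matrices, entrywise and as sesquilinear forms\<close>

lemma mat_sum_Suc:
  assumes "\<And>j. j < Suc m \<Longrightarrow> f j \<in> carrier_mat n n"
  shows "mat_sum n f (Suc m) = f m + mat_sum n f m"
proof -
  interpret abelian_group "module_mat TYPE(complex) n n" by (rule abelian_group_mat)
  show ?thesis
    using assms unfolding lessThan_Suc
    by (subst finsum_insert) (auto simp: module_mat_simps)
qed

lemma mat_sum_0: "mat_sum n f 0 = 0\<^sub>m n n"
proof -
  interpret abelian_group "module_mat TYPE(complex) n n" by (rule abelian_group_mat)
  show ?thesis by (simp add: module_mat_simps)
qed

lemma mat_sum_eq_mat:
  assumes "\<And>j. j < m \<Longrightarrow> f j \<in> carrier_mat n n"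
  shows "mat_sum n f m = mat n n (\<lambda>rs. \<Sum>j<m. f j $$ rs)"
  using assms
proof (induction m)
  case 0
  show ?case unfolding mat_sum_0 by (intro eq_matI) auto
next
  case (Suc m)
  have "mat_sum n f (Suc m) = f m + mat_sum n f m"
    by (rule mat_sum_Suc) (rule Suc.prems)
  with Suc show ?case by (intro eq_matI) auto
qed

lemma mat_sum_carrier [simp]:
  assumes "\<And>j. j < m \<Longrightarrow> f j \<in> carrier_mat n n"
  shows "mat_sum n f m \<in> carrier_mat n n"
  using mat_sum_eq_mat[OF assms] by simp

lemma mat_sum_cong:
  assumes "\<And>j. j < m \<Longrightarrow> f j = g j" "\<And>j. j < m \<Longrightarrow> g j \<in> carrier_mat n n"
  shows "mat_sum n f m = mat_sum n g m"
  using assms by (auto simp: mat_sum_eq_mat)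

lemma cscalar_prod_mat_sum:
  assumes "\<And>j. j < m \<Longrightarrow> f j \<in> carrier_mat n n" "x \<in> carrier_vec n" "y \<in> carrier_vec n"
  shows "(mat_sum n f m *\<^sub>v x) \<bullet>c y = (\<Sum>j<m. (f j *\<^sub>v x) \<bullet>c y)"
  using assms(1)
proof (induction m)
  case 0
  show ?case unfolding mat_sum_0 using assms(2,3) by (simp add: cscalar_prod_mult_mat_vec[of _ n n])
next
  case (Suc m)
  have "mat_sum n f (Suc m) = f m + mat_sum n f m"
    by (rule mat_sum_Suc) (rule Suc.prems)
  moreover have "mat_sum n f m \<in> carrier_mat n n" using Suc.prems by simp
  ultimately show ?case
    using Suc assms(2,3)
    by (simp add: add_mult_distrib_mat_vec[of _ n n] add_scalar_prod_distrib[of _ n] mult_mat_vec_carrier[of _ n n])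
qed

lemma mat_sum_add:
  assumes f: "\<And>j. j < m \<Longrightarrow> f j \<in> carrier_mat n n" and h: "\<And>j. j < m \<Longrightarrow> h j \<in> carrier_mat n n"
  shows "mat_sum n (\<lambda>j. f j + h j) m = mat_sum n f m + mat_sum n h m"
proof (rule mat_eqI_cscalar_prod[of _ n n])
  fix x y :: "complex vec" assume xy: "x \<in> carrier_vec n" "y \<in> carrier_vec n"
  have "((f j + h j) *\<^sub>v x) \<bullet>c y = (f j *\<^sub>v x) \<bullet>c y + (h j *\<^sub>v x) \<bullet>c y" if "j < m" for j
    using f[OF that] h[OF that] xy
    by (simp add: cscalar_prod_mult_mat_vec[of _ n n] distrib_right sum.distrib)
  moreover have "mat_sum n f m \<in> carrier_mat n n" "mat_sum n h m \<in> carrier_mat n n"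
    using f h by auto
  moreover from this have "((mat_sum n f m + mat_sum n h m) *\<^sub>v x) \<bullet>c y =
    (mat_sum n f m *\<^sub>v x) \<bullet>c y + (mat_sum n h m *\<^sub>v x) \<bullet>c y"
    using xy by (simp add: cscalar_prod_mult_mat_vec[of _ n n] distrib_right sum.distrib)
  ultimately show "(mat_sum n (\<lambda>j. f j + h j) m *\<^sub>v x) \<bullet>c y =
    ((mat_sum n f m + mat_sum n h m) *\<^sub>v x) \<bullet>c y"
    using f h xy by (simp add: cscalar_prod_mat_sum sum.distrib)
qed (use f h in auto)

lemma mat_sum_smult:
  assumes f: "\<And>j. j < m \<Longrightarrow> f j \<in> carrier_mat n n"
  shows "mat_sum n (\<lambda>j. c \<cdot>\<^sub>m f j) m = c \<cdot>\<^sub>m mat_sum n f m"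
proof (rule mat_eqI_cscalar_prod[of _ n n])
  fix x y :: "complex vec" assume xy: "x \<in> carrier_vec n" "y \<in> carrier_vec n"
  have smult: "((c \<cdot>\<^sub>m A) *\<^sub>v x) \<bullet>c y = c * ((A *\<^sub>v x) \<bullet>c y)" if "A \<in> carrier_mat n n" for A
    using that xy by (simp add: cscalar_prod_mult_mat_vec[of _ n n] sum_distrib_left mult.assoc)
  then show "(mat_sum n (\<lambda>j. c \<cdot>\<^sub>m f j) m *\<^sub>v x) \<bullet>c y = ((c \<cdot>\<^sub>m mat_sum n f m) *\<^sub>v x) \<bullet>c y"
    using f xy by (simp add: cscalar_prod_mat_sum sum_distrib_left)
qed (use f in auto)

lemma mat_adjoint_mat_sum:
  assumes "\<And>j. j < m \<Longrightarrow> f j \<in> carrier_mat n n"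
  shows "mat_adjoint (mat_sum n f m) = mat_sum n (\<lambda>j. mat_adjoint (f j)) m"
proof -
  have "mat_adjoint (f j) \<in> carrier_mat n n" if "j < m" for j using assms[OF that] by simp
  moreover have "mat_adjoint (f j) $$ (i, k) = cnj (f j $$ (k, i))" if "j < m" "i < n" "k < n" for i j k
    using assms[OF that(1)] that by simp
  ultimately show ?thesis
    using assms by (intro eq_matI) (auto simp: mat_sum_eq_mat intro!: sum.cong)
qed

section \<open>Tuples and sums of compressions\<close>

lemma mtuples_nth: "a \<in> mtuples g n \<Longrightarrow> i < g \<Longrightarrow> a ! i \<in> carrier_mat n n"
  by (auto simp: mtuples_def dest!: subsetD intro!: nth_mem)

lemma compress_carrier:
  fixes \<gamma> X :: "complex mat"
  assumes "\<gamma> \<in> carrier_mat N n" "X \<in> carrier_mat N N"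
  shows "mat_adjoint \<gamma> * X * \<gamma> \<in> carrier_mat n n"
  using assms by (metis mult_carrier_mat mat_adjoint_carrier)

text \<open>Each adjoint coefficient moves across the inner product. The formula serves the
  normalisation of the coefficients (X j = 1), the combination itself, and complete positivity of
  combined maps.\<close>

lemma cscalar_prod_compress_sum:
  assumes "\<And>j. j < m \<Longrightarrow> \<gamma> j \<in> carrier_mat (N j) n"
    and "\<And>j. j < m \<Longrightarrow> X j \<in> carrier_mat (N j) (N j)"
    and "x \<in> carrier_vec n" "y \<in> carrier_vec n"
  shows "(mat_sum n (\<lambda>j. mat_adjoint (\<gamma> j) * X j * \<gamma> j) m *\<^sub>v x) \<bullet>c y =
    (\<Sum>j<m. (X j *\<^sub>v (\<gamma> j *\<^sub>v x)) \<bullet>c (\<gamma> j *\<^sub>v y))"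
proof (subst cscalar_prod_mat_sum)
  show "(\<Sum>j<m. (mat_adjoint (\<gamma> j) * X j * \<gamma> j *\<^sub>v x) \<bullet>c y) =
    (\<Sum>j<m. (X j *\<^sub>v (\<gamma> j *\<^sub>v x)) \<bullet>c (\<gamma> j *\<^sub>v y))"
  proof (rule sum.cong)
    fix j assume j: "j \<in> {..<m}"
    then have c: "\<gamma> j \<in> carrier_mat (N j) n" "X j \<in> carrier_mat (N j) (N j)"
      using assms by auto
    then have "mat_adjoint (\<gamma> j) * X j * \<gamma> j *\<^sub>v x = mat_adjoint (\<gamma> j) *\<^sub>v (X j *\<^sub>v (\<gamma> j *\<^sub>v x))"
      using assms(3) by (simp add: assoc_mult_mat_vec[of _ n "N j" _ n] assoc_mult_mat_vec[of _ n "N j" _ "N j"]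
        mult_carrier_mat[of _ n "N j"])
    then show "(mat_adjoint (\<gamma> j) * X j * \<gamma> j *\<^sub>v x) \<bullet>c y = (X j *\<^sub>v (\<gamma> j *\<^sub>v x)) \<bullet>c (\<gamma> j *\<^sub>v y)"
      using c assms(3,4) by (simp add: cscalar_prod_adjoint'[of _ "N j" n])
  qed simp
  show "mat_adjoint (\<gamma> j) * X j * \<gamma> j \<in> carrier_mat n n" if "j < m" for j
    using assms(1,2)[OF that] by (metis mult_carrier_mat mat_adjoint_carrier)
qed fact+

section \<open>Convex combinations of contractions that are unitary\<close>

text \<open>Since \<open>U\<close> is isometric, expanding the squares shows that the sum over \<open>j\<close> of
  \<open>\<parallel>X\<^sub>j \<gamma>\<^sub>j x - \<gamma>\<^sub>j U x\<parallel>\<^sup>2\<close> is at most \<open>\<parallel>x\<parallel>\<^sup>2 - \<parallel>U x\<parallel>\<^sup>2 = 0\<close>.\<close>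

lemma intertwine_of_contraction:
  assumes U: "U \<in> carrier_mat n n" "mat_adjoint U * U = 1\<^sub>m n"
    and \<gamma>: "\<And>j. j < m \<Longrightarrow> \<gamma> j \<in> carrier_mat (N j) n"
    and X: "\<And>j. j < m \<Longrightarrow> X j \<in> carrier_mat (N j) (N j)"
    and contr: "\<And>j y. j < m \<Longrightarrow> y \<in> carrier_vec (N j) \<Longrightarrow> (X j *\<^sub>v y) \<bullet>c (X j *\<^sub>v y) \<le> y \<bullet>c y"
    and one: "mat_sum n (\<lambda>j. mat_adjoint (\<gamma> j) * \<gamma> j) m = 1\<^sub>m n"
    and comb: "mat_sum n (\<lambda>j. mat_adjoint (\<gamma> j) * X j * \<gamma> j) m = U"
    and j: "j < m"
  shows "X j * \<gamma> j = \<gamma> j * U"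
proof (rule mat_eqI_mult_vec)
  show "X j * \<gamma> j \<in> carrier_mat (N j) n" "\<gamma> j * U \<in> carrier_mat (N j) n"
    using U(1) \<gamma>[OF j] X[OF j] by (auto intro: mult_carrier_mat)
  fix x :: "complex vec" assume x: "x \<in> carrier_vec n"
  define z where "z = U *\<^sub>v x"
  have z: "z \<in> carrier_vec n" unfolding z_def using U x by simp
  have zz: "z \<bullet>c z = x \<bullet>c x" unfolding z_def by (rule isometry_cscalar_prod[OF U x])
  \<comment> \<open>The coefficients stacked on top of each other form an isometry, which preserves
    inner products.\<close>
  have one': "(\<Sum>j<m. (\<gamma> j *\<^sub>v a) \<bullet>c (\<gamma> j *\<^sub>v b)) = a \<bullet>c b"
    if ab: "a \<in> carrier_vec n" "b \<in> carrier_vec n" for a b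
  proof -
    have "mat_sum n (\<lambda>j. mat_adjoint (\<gamma> j) * 1\<^sub>m (N j) * \<gamma> j) m = 1\<^sub>m n"
      unfolding one[symmetric]
    proof (rule mat_sum_cong)
      fix j assume "j < m"
      then have "\<gamma> j \<in> carrier_mat (N j) n" by fact
      then show "mat_adjoint (\<gamma> j) * 1\<^sub>m (N j) * \<gamma> j = mat_adjoint (\<gamma> j) * \<gamma> j"
        by (simp add: right_mult_one_mat[of _ n])
      show "mat_adjoint (\<gamma> j) * \<gamma> j \<in> carrier_mat n n"
        using \<open>\<gamma> j \<in> carrier_mat (N j) n\<close> by (auto intro: mult_carrier_mat)
    qed
    then have "a \<bullet>c b = (\<Sum>j<m. (1\<^sub>m (N j) *\<^sub>v (\<gamma> j *\<^sub>v a)) \<bullet>c (\<gamma> j *\<^sub>v b))"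
      using cscalar_prod_compress_sum[of m \<gamma> N n "\<lambda>j. 1\<^sub>m (N j)" a b] \<gamma> ab by simp
    also have "\<dots> = (\<Sum>j<m. (\<gamma> j *\<^sub>v a) \<bullet>c (\<gamma> j *\<^sub>v b))"
      using \<gamma> ab by (intro sum.cong refl) (simp add: one_mult_mat_vec[OF mult_mat_vec_carrier[of _ _ n]])
    finally show ?thesis by simp
  qed
  \<comment> \<open>The combination is U, so the mixed terms add up to U x tested against z = U
    x.\<close>
  have cross: "(\<Sum>j<m. (X j *\<^sub>v (\<gamma> j *\<^sub>v x)) \<bullet>c (\<gamma> j *\<^sub>v z)) = z \<bullet>c z"
    using cscalar_prod_compress_sum[of m \<gamma> N n X x z] \<gamma> X x z by (simp add: comb z_def)
  define d where "d j = X j *\<^sub>v (\<gamma> j *\<^sub>v x) - \<gamma> j *\<^sub>v z" for j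
  have dd: "d j \<bullet>c d j = (X j *\<^sub>v (\<gamma> j *\<^sub>v x)) \<bullet>c (X j *\<^sub>v (\<gamma> j *\<^sub>v x))
      - (X j *\<^sub>v (\<gamma> j *\<^sub>v x)) \<bullet>c (\<gamma> j *\<^sub>v z) - cnj ((X j *\<^sub>v (\<gamma> j *\<^sub>v x)) \<bullet>c (\<gamma> j *\<^sub>v z))
      + (\<gamma> j *\<^sub>v z) \<bullet>c (\<gamma> j *\<^sub>v z)" if j: "j < m" for j
  proof -
    have c: "X j *\<^sub>v (\<gamma> j *\<^sub>v x) \<in> carrier_vec (N j)" "\<gamma> j *\<^sub>v z \<in> carrier_vec (N j)"
      using \<gamma>[OF j] X[OF j] x z by auto
    show ?thesis
      unfolding d_def cnj_cscalar_prod[OF c] using c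
      by (simp add: minus_scalar_prod_distrib[of _ "N j"] cscalar_prod_minus_right[of _ "N j"])
  qed
  \<comment> \<open>Only the first square is estimated, by contractivity; the sums of the other
    terms are known exactly from \<open>cross\<close> and \<open>one'\<close>.\<close>
  have "(\<Sum>j<m. d j \<bullet>c d j) \<le> (\<Sum>j<m. (\<gamma> j *\<^sub>v x) \<bullet>c (\<gamma> j *\<^sub>v x)
      - (X j *\<^sub>v (\<gamma> j *\<^sub>v x)) \<bullet>c (\<gamma> j *\<^sub>v z) - cnj ((X j *\<^sub>v (\<gamma> j *\<^sub>v x)) \<bullet>c (\<gamma> j *\<^sub>v z))
      + (\<gamma> j *\<^sub>v z) \<bullet>c (\<gamma> j *\<^sub>v z))"
    by (intro sum_mono, subst dd, simp)
      (intro add_right_mono diff_right_mono contr, use \<gamma> x in \<open>auto intro: mult_mat_vec_carrier\<close>)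
  also have "\<dots> = x \<bullet>c x - z \<bullet>c z - cnj (z \<bullet>c z) + z \<bullet>c z"
    using x z by (simp only: sum.distrib sum_subtractf one' cross cnj_sum[symmetric])
  also have "\<dots> = 0" using zz cnj_cscalar_prod[OF z z] by simp
  finally have "(\<Sum>j<m. d j \<bullet>c d j) = 0"
    by (intro antisym sum_nonneg) (auto simp: conjugate_square_ge_0_vec)
  then have "d j \<bullet>c d j = 0"
    using j by (subst (asm) sum_nonneg_eq_0_iff) (auto simp: conjugate_square_ge_0_vec)
  moreover have dc: "d j \<in> carrier_vec (N j)" unfolding d_def using \<gamma>[OF j] X[OF j] x z by auto
  ultimately have d0: "d j = 0\<^sub>v (N j)" by simp
  have "(X j *\<^sub>v (\<gamma> j *\<^sub>v x)) $ i = (\<gamma> j *\<^sub>v z) $ i" if "i < N j" for i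
    using arg_cong[OF d0, of "\<lambda>v. v $ i"] that \<gamma>[OF j] X[OF j] unfolding d_def by simp
  then have "X j *\<^sub>v (\<gamma> j *\<^sub>v x) = \<gamma> j *\<^sub>v z"
    using \<gamma>[OF j] X[OF j] by (intro eq_vecI) auto
  then show "X j * \<gamma> j *\<^sub>v x = \<gamma> j * U *\<^sub>v x"
    using \<gamma>[OF j] X[OF j] U(1) x unfolding z_def by simp
qed

section \<open>Reducing isometries\<close>

lemma wide_mat_kernel:
  fixes A :: "complex mat"
  assumes A: "A \<in> carrier_mat m n" and "m < n"
  obtains x where "x \<in> carrier_vec n" "x \<noteq> 0\<^sub>v n" "A *\<^sub>v x = 0\<^sub>v m"
proof -
  \<comment> \<open>Padding \<open>A\<close> with zero rows gives a singular square matrix.\<close>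
  define B where "B = mat n n (\<lambda>(i, j). if i < m then A $$ (i, j) else 0)"
  have B: "B \<in> carrier_mat n n" unfolding B_def by simp
  have "row B (n - 1) = 0\<^sub>v n"
    using assms by (intro eq_vecI) (auto simp: B_def)
  then have "B = mat\<^sub>r n n (\<lambda>i. if i = n - 1 then 0\<^sub>v n else row B i)"
    using B by (intro eq_matI) (auto simp: vec_eq_iff)
  moreover have "det (mat\<^sub>r n n (\<lambda>i. if i = n - 1 then 0\<^sub>v n else row B i)) = 0"
    using B \<open>m < n\<close> by (intro det_row_0) auto
  ultimately have "det B = 0" by simp
  then obtain x where x: "x \<in> carrier_vec n" "x \<noteq> 0\<^sub>v n" "B *\<^sub>v x = 0\<^sub>v n"
    using det_0_iff_vec_prod_zero[OF B] by auto
  have "A *\<^sub>v x = 0\<^sub>v m"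
  proof (rule eq_vecI)
    fix i assume i: "i < dim_vec (0\<^sub>v m :: complex vec)"
    then have "row B i = row A i" using assms by (intro eq_vecI) (auto simp: B_def)
    then have "(A *\<^sub>v x) $ i = (B *\<^sub>v x) $ i" using i assms B by simp
    then show "(A *\<^sub>v x) $ i = (0\<^sub>v m) $ i" using x i assms by simp
  qed (use A in auto)
  with x that show ?thesis by blast
qed

text \<open>Since \<open>\<bullet>c\<close> conjugates its second argument, entry (i, j) of the Gram
  matrix pairs column j with column i, in this order.\<close>

lemma isometry_iff_orthonormal_cols:
  fixes W :: "complex mat"
  assumes W: "W \<in> carrier_mat N k"
  shows "mat_adjoint W * W = 1\<^sub>m k \<longleftrightarrow>
    (\<forall>i<k. \<forall>j<k. col W j \<bullet>c col W i = (if i = j then 1 else 0))"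
proof -
  have "(mat_adjoint W * W) $$ (i, j) = col W j \<bullet>c col W i" if "i < k" "j < k" for i j
    using W that by (auto simp: scalar_prod_def mult.commute intro!: sum.cong)
  moreover have "mat_adjoint W * W \<in> carrier_mat k k" using W by (auto intro: mult_carrier_mat)
  ultimately show ?thesis by (auto simp: mat_eq_iff)
qed

lemma index_adjoint_mult_vec:
  fixes W :: "complex mat"
  assumes "W \<in> carrier_mat N k" "x \<in> carrier_vec N" "i < k"
  shows "(mat_adjoint W *\<^sub>v x) $ i = x \<bullet>c col W i"
  using assms by (auto simp: scalar_prod_def mult.commute intro!: sum.cong)

text \<open>The kernel of the adjoint of W is the orthogonal complement of the columns of W. The
  adjoint has fewer rows than columns, so this kernel contains a nonzero vector, which is normalised
  and appended.\<close>

lemma isometry_extend_col: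
  fixes W :: "complex mat"
  assumes W: "W \<in> carrier_mat N k" "mat_adjoint W * W = 1\<^sub>m k" and "k < N"
  obtains V where "V \<in> carrier_mat N (Suc k)" "mat_adjoint V * V = 1\<^sub>m (Suc k)"
    "\<And>j. j < k \<Longrightarrow> col V j = col W j"
proof -
  have "mat_adjoint W \<in> carrier_mat k N" using W by simp
  from wide_mat_kernel[OF this \<open>k < N\<close>] obtain x where
    x: "x \<in> carrier_vec N" "x \<noteq> 0\<^sub>v N" "mat_adjoint W *\<^sub>v x = 0\<^sub>v k" .
  define s :: complex where "s = complex_of_real (1 / sqrt (Re (x \<bullet>c x)))"
  have pos: "0 < x \<bullet>c x" using x by simp
  define v where "v = s \<cdot>\<^sub>v x"
  have v: "v \<in> carrier_vec N" unfolding v_def using x by simp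
  have "v \<bullet>c v = s * cnj s * (x \<bullet>c x)"
    unfolding v_def using x(1) by (simp add: cscalar_prod_smult[of _ N])
  also have "x \<bullet>c x = complex_of_real (Re (x \<bullet>c x))"
    using pos by (simp add: complex_eq_iff less_complex_def)
  also have "s * cnj s * complex_of_real (Re (x \<bullet>c x)) = 1"
    using pos by (simp add: s_def less_complex_def flip: of_real_mult)
  finally have vv: "v \<bullet>c v = 1" .
  have vW: "v \<bullet>c col W i = 0" if i: "i < k" for i
  proof -
    have "v \<bullet>c col W i = s * (x \<bullet>c col W i)"
      unfolding v_def using W x(1) by (intro cscalar_prod_smult[of _ N]) auto
    also have "x \<bullet>c col W i = 0"
      using index_adjoint_mult_vec[OF W(1) x(1) i] x(3) i by simp
    finally show ?thesis by simp
  qed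
  have Wv: "col W i \<bullet>c v = 0" if i: "i < k" for i
    using vW[OF i] cnj_cscalar_prod[OF v, of "col W i"] W by (simp add: carrier_vecI)
  define V where "V = mat N (Suc k) (\<lambda>(i, j). if j < k then W $$ (i, j) else v $ i)"
  have V: "V \<in> carrier_mat N (Suc k)" unfolding V_def by simp
  have colV: "col V j = (if j < k then col W j else v)" if "j < Suc k" for j
    using W(1) v that by (intro eq_vecI) (auto simp: V_def)
  have "col W j \<bullet>c col W i = (if i = j then 1 else 0)" if "i < k" "j < k" for i j
    using isometry_iff_orthonormal_cols[OF W(1)] W(2) that by blast
  then have "mat_adjoint V * V = 1\<^sub>m (Suc k)"
    unfolding isometry_iff_orthonormal_cols[OF V]
    by (auto simp: colV vv vW Wv less_Suc_eq)
  with V colV that show ?thesis by simp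
qed

lemma isometry_extend_unitary:
  fixes W :: "complex mat"
  assumes "W \<in> carrier_mat N k" "mat_adjoint W * W = 1\<^sub>m k" and "k \<le> N"
  obtains U where "unitary N U" "\<And>j. j < k \<Longrightarrow> col U j = col W j"
proof -
  have "\<exists>U. unitary N U \<and> (\<forall>j<k. col U j = col W j)"
    using assms(3,1,2)
  \<comment> \<open>Downward induction from k = N, where a square isometry is already unitary; a
    step appends one column and keeps the earlier ones.\<close>
  proof (induction k arbitrary: W rule: inc_induct)
    case base
    then show ?case
      by (auto simp: unitary_def intro!: exI[of _ W] mat_mult_left_right_inverse[of "mat_adjoint W" N])
  next
    case (step k)
    obtain V where V: "V \<in> carrier_mat N (Suc k)" "mat_adjoint V * V = 1\<^sub>m (Suc k)"
      "\<And>j. j < k \<Longrightarrow> col V j = col W j"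
      using isometry_extend_col[OF step.prems step.hyps(2)] by metis
    from step.IH[OF V(1,2)] V(3) show ?case by (metis less_SucI)
  qed
  with that show ?thesis by blast
qed

text \<open>An isometry has trivial kernel, a matrix with more columns than rows does not. This is
  what excludes levels below n for the points of a combination.\<close>

lemma isometry_dim_le:
  fixes W :: "complex mat"
  assumes W: "W \<in> carrier_mat N k" "mat_adjoint W * W = 1\<^sub>m k"
  shows "k \<le> N"
proof (rule ccontr)
  assume "\<not> k \<le> N"
  then have "N < k" by simp
  from wide_mat_kernel[OF W(1) this] obtain x where
    x: "x \<in> carrier_vec k" "x \<noteq> 0\<^sub>v k" "W *\<^sub>v x = 0\<^sub>v N" .
  have "mat_adjoint W \<in> carrier_mat k N" using W(1) by simp
  then have "mat_adjoint W * W *\<^sub>v x = mat_adjoint W *\<^sub>v 0\<^sub>v N"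
    using W(1) x by (simp add: assoc_mult_mat_vec[of _ k N _ k])
  also have "\<dots> = 0\<^sub>v k" using W(1) by (intro eq_vecI) auto
  finally show False using W x by simp
qed

text \<open>The first k columns of U are an orthonormal basis of the range of W. In the basis given
  by U, the relation for x turns the first k columns into b above 0, and the relation for the
  adjoint of x kills the upper right block.\<close>

lemma reducing_isometry_diag_block:
  assumes U: "unitary N U" and W: "W \<in> carrier_mat N k" and "k \<le> N"
    and UW: "\<And>j. j < k \<Longrightarrow> col U j = col W j"
    and x: "x \<in> carrier_mat N N" and b: "b \<in> carrier_mat k k"
    and red: "x * W = W * b" "mat_adjoint x * W = W * mat_adjoint b"
  obtains c where "c \<in> carrier_mat (N - k) (N - k)"
    "diag_block_mat [b, c] = mat_adjoint U * x * U"
proof -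
  have Uc: "U \<in> carrier_mat N N" and UU: "mat_adjoint U * U = 1\<^sub>m N"
    using U by (auto simp: unitary_def)
  define M where "M = mat_adjoint U * x * U"
  have M: "M \<in> carrier_mat N N"
    unfolding M_def using Uc x by (metis mult_carrier_mat mat_adjoint_carrier)
  have M_entry: "M $$ (r, s) = (x *\<^sub>v col U s) \<bullet>c col U r" if "r < N" "s < N" for r s
  proof -
    have "mat_adjoint U \<in> carrier_mat N N" using Uc by simp
    then have "M = mat_adjoint U * (x * U)" unfolding M_def using Uc x by (simp add: assoc_mult_mat[of _ N N _ N])
    moreover have "col (mat_adjoint U * (x * U)) s = mat_adjoint U *\<^sub>v col (x * U) s"
      using that Uc x by (intro col_mult2[of _ N N _ N]) auto
    moreover have "col (x * U) s = x *\<^sub>v col U s"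
      using that Uc x by (intro col_mult2[of _ N N _ N]) auto
    ultimately have "col M s = mat_adjoint U *\<^sub>v (x *\<^sub>v col U s)" by simp
    moreover have "M $$ (r, s) = col M s $ r" using that M by simp
    moreover have "x *\<^sub>v col U s \<in> carrier_vec N" using that Uc x by auto
    ultimately show ?thesis using that Uc by (simp add: index_adjoint_mult_vec[of _ N N] del: index_mult_mat_vec)
  qed
  \<comment> \<open>By orthonormality this is a standard basis vector for r < k and the zero vector
    for r \<ge> k.\<close>
  have WU: "mat_adjoint W *\<^sub>v col U r = vec k (\<lambda>i. if i = r then 1 else 0)" if r: "r < N" for r
  proof (rule eq_vecI)
    fix i assume "i < dim_vec (vec k (\<lambda>i. if i = r then 1 else 0) :: complex vec)"
    then have i: "i < k" by simp
    have "(mat_adjoint W *\<^sub>v col U r) $ i = col U r \<bullet>c col U i"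
      using W Uc r i UW by (subst index_adjoint_mult_vec) auto
    also have "\<dots> = (if i = r then 1 else 0)"
      using UU isometry_iff_orthonormal_cols[OF Uc] r i \<open>k \<le> N\<close> by auto
    finally show "(mat_adjoint W *\<^sub>v col U r) $ i = (vec k (\<lambda>i. if i = r then 1 else 0)) $ i"
      using i by simp
  qed (use W in simp)
  have left: "M $$ (r, s) = (if r < k then b $$ (r, s) else 0)" if rs: "r < N" "s < k" for r s
  proof -
    have "x *\<^sub>v col U s = col (x * W) s"
      using UW rs x W by (subst col_mult2[of _ N N _ k]) auto
    also have "\<dots> = W *\<^sub>v col b s"
      unfolding red using W b rs by (subst col_mult2[of _ N k _ k]) auto
    finally have "M $$ (r, s) = (W *\<^sub>v col b s) \<bullet>c col U r"
      using rs \<open>k \<le> N\<close> by (simp add: M_entry)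
    also have "\<dots> = col b s \<bullet>c (mat_adjoint W *\<^sub>v col U r)"
      using W b Uc rs by (intro cscalar_prod_adjoint) auto
    also have "\<dots> = (\<Sum>i<k. if r = i then col b s $ i else 0)"
      by (subst WU[OF rs(1)], subst cscalar_prod_sum[of _ k], simp) (rule sum.cong, simp_all)
    also have "\<dots> = (if r < k then b $$ (r, s) else 0)"
      using b rs by simp
    finally show ?thesis .
  qed
  have right: "M $$ (r, s) = 0" if rs: "r < k" "k \<le> s" "s < N" for r s
  proof -
    have "mat_adjoint x *\<^sub>v col U r = col (mat_adjoint x * W) r"
      using UW rs x W by (subst col_mult2[of _ N N _ k]) auto
    also have "\<dots> = W *\<^sub>v col (mat_adjoint b) r"
      unfolding red using W b rs by (subst col_mult2[of _ N k _ k]) auto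
    finally have eq: "mat_adjoint x *\<^sub>v col U r = W *\<^sub>v col (mat_adjoint b) r" .
    have "M $$ (r, s) = (x *\<^sub>v col U s) \<bullet>c col U r"
      using rs by (simp add: M_entry)
    also have "\<dots> = col U s \<bullet>c (W *\<^sub>v col (mat_adjoint b) r)"
      unfolding eq[symmetric] using x Uc rs by (intro cscalar_prod_adjoint) auto
    also have "\<dots> = (mat_adjoint W *\<^sub>v col U s) \<bullet>c col (mat_adjoint b) r"
      using W b Uc rs by (intro cscalar_prod_adjoint'[symmetric]) auto
    also have "\<dots> = 0"
      unfolding WU[OF rs(3)] using rs b by (subst cscalar_prod_sum[of _ k]) (auto intro!: sum.neutral)
    finally show ?thesis .
  qed
  define c where "c = mat (N - k) (N - k) (\<lambda>(r, s). M $$ (r + k, s + k))"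
  have "diag_block_mat [b, c] = M"
    using M b left right \<open>k \<le> N\<close>
    by (intro eq_matI) (auto simp: c_def Let_def)
  with that[of c] show ?thesis by (simp add: c_def M_def)
qed

text \<open>In equal dimensions W itself is the unitary; otherwise a completion of W is. The
  completion depends on W only, so a single unitary serves all coordinates of the tuple, while the
  complementary blocks are chosen coordinate by coordinate.\<close>

lemma reducing_isometry_cases:
  assumes a: "a \<in> mtuples g N" and b: "b \<in> mtuples g n"
    and W: "W \<in> carrier_mat N n" "mat_adjoint W * W = 1\<^sub>m n"
    and red: "\<And>i. i < g \<Longrightarrow> a ! i * W = W * b ! i"
      "\<And>i. i < g \<Longrightarrow> mat_adjoint (a ! i) * W = W * mat_adjoint (b ! i)"
  shows "N = n \<and> unitarily_equiv n a b \<or>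
    N > n \<and> (\<exists>c \<in> mtuples g (N - n). unitarily_equiv N a (tuple_dsum b c))"
proof -
  note ai = mtuples_nth[OF a] and bi = mtuples_nth[OF b]
  have len: "length a = g" "length b = g" using a b by (auto simp: mtuples_def)
  have Wc: "mat_adjoint W \<in> carrier_mat n N" using W by simp
  have "n \<le> N" using isometry_dim_le[OF W] .
  then consider "N = n" | "n < N" by linarith
  then show ?thesis
  proof cases
    case 1
    have "unitary n W"
      using W Wc 1 by (auto simp: unitary_def intro: mat_mult_left_right_inverse)
    moreover have "b = compress W a"
    proof (rule nth_equalityI)
      fix i assume "i < length b"
      then have i: "i < g" using len by simp
      have "mat_adjoint W * a ! i * W = mat_adjoint W * (W * b ! i)"
        using red(1)[OF i] Wc W(1) ai[OF i] by (simp add: assoc_mult_mat[of _ n N _ N])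
      also have "\<dots> = mat_adjoint W * W * b ! i"
        using Wc W(1) bi[OF i] by (simp add: assoc_mult_mat[of _ n N _ n])
      finally show "b ! i = compress W a ! i"
        using W bi[OF i] i len by (simp add: compress_def)
    qed (simp add: len compress_def)
    ultimately show ?thesis using 1 unfolding unitarily_equiv_def by blast
  next
    case 2
    obtain U where U: "unitary N U" "\<And>j. j < n \<Longrightarrow> col U j = col W j"
      using isometry_extend_unitary[OF W \<open>n \<le> N\<close>] by metis
    have "\<exists>c. c \<in> carrier_mat (N - n) (N - n) \<and>
        diag_block_mat [b ! i, c] = mat_adjoint U * a ! i * U" if i: "i < g" for i
      using reducing_isometry_diag_block[OF U(1) W(1) \<open>n \<le> N\<close> U(2) ai[OF i] bi[OF i] red[OF i]]
      by metis
    then obtain C where C: "\<And>i. i < g \<Longrightarrow> C i \<in> carrier_mat (N - n) (N - n)"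
      "\<And>i. i < g \<Longrightarrow> diag_block_mat [b ! i, C i] = mat_adjoint U * a ! i * U"
      by metis
    have "map C [0..<g] \<in> mtuples g (N - n)" using C(1) by (auto simp: mtuples_def)
    moreover have "tuple_dsum b (map C [0..<g]) = compress U a"
      using len C(2) by (intro nth_equalityI) (auto simp: tuple_dsum_def compress_def)
    ultimately show ?thesis using 2 U(1) unfolding unitarily_equiv_def by blast
  qed
qed

section \<open>Positivity of block matrices\<close>

text \<open>Writing an index below k * n as i * n + r identifies vectors of length k * n with
  k-tuples of vectors of length n. Later positivity arguments then work with blocks instead of
  \<open>div\<close> and \<open>mod\<close>.\<close>

lemma pos_semidef_block_mat_iff:
  assumes X: "\<And>i j. i < k \<Longrightarrow> j < k \<Longrightarrow> X i j \<in> carrier_mat n n"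
  shows "pos_semidef (k * n) (block_mat k n X) \<longleftrightarrow>
    (\<forall>y. (\<forall>i<k. y i \<in> carrier_vec n) \<longrightarrow> 0 \<le> (\<Sum>i<k. \<Sum>j<k. (X i j *\<^sub>v y j) \<bullet>c y i))"
    (is "_ \<longleftrightarrow> (\<forall>y. ?C y \<longrightarrow> 0 \<le> ?Q y)")
proof -
  have split: "(\<Sum>r<k * n. f r) = (\<Sum>i<k. \<Sum>r<n. f (i * n + r))" for f :: "nat \<Rightarrow> complex"
  proof -
    have "(\<Sum>r<k * n. f r) = (\<Sum>i<k. sum f {i * n..<i * n + n})"
      by (rule sum.nat_group[symmetric])
    also have "\<dots> = (\<Sum>i<k. \<Sum>r<n. f (i * n + r))"
    proof (rule sum.cong[OF refl])
      show "sum f {i * n..<i * n + n} = (\<Sum>r<n. f (i * n + r))" for i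
        using sum.shift_bounds_nat_ivl[of f 0 "i * n" n] by (simp add: add.commute atLeast0LessThan)
    qed
    finally show ?thesis .
  qed
  have idx: "i * n + r < k * n" if "i < k" "r < n" for i r
  proof -
    have "i * n + r < Suc i * n" using that by simp
    also have "\<dots> \<le> k * n" using that by (intro mult_right_mono) auto
    finally show ?thesis .
  qed
  have main: "(block_mat k n X *\<^sub>v z) \<bullet>c z = ?Q y"
    if z: "z \<in> carrier_vec (k * n)" and y: "\<And>i. i < k \<Longrightarrow> y i \<in> carrier_vec n"
      and zy: "\<And>i r. i < k \<Longrightarrow> r < n \<Longrightarrow> z $ (i * n + r) = y i $ r" for z y
  proof -
    have "(block_mat k n X *\<^sub>v z) \<bullet>c z =
      (\<Sum>r<k * n. \<Sum>s<k * n. block_mat k n X $$ (r, s) * z $ s * cnj (z $ r))"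
      using z by (intro cscalar_prod_mult_mat_vec) (auto simp: block_mat_def)
    also have "\<dots> = (\<Sum>i<k. \<Sum>r<n. \<Sum>j<k. \<Sum>s<n. X i j $$ (r, s) * y j $ s * cnj (y i $ r))"
      unfolding split by (intro sum.cong refl) (auto simp: block_mat_def idx zy)
    also have "\<dots> = (\<Sum>i<k. \<Sum>j<k. \<Sum>r<n. \<Sum>s<n. X i j $$ (r, s) * y j $ s * cnj (y i $ r))"
      by (intro sum.cong refl sum.swap)
    also have "\<dots> = ?Q y"
      using X y by (intro sum.cong refl cscalar_prod_mult_mat_vec[symmetric]) auto
    finally show ?thesis .
  qed
  show ?thesis
  proof (intro iffI allI impI)
    fix y assume ps: "pos_semidef (k * n) (block_mat k n X)" and y: "?C y"
    \<comment> \<open>The vectors y i stacked into one; the converse direction cuts z into pieces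
      again.\<close>
    define z where "z = vec (k * n) (\<lambda>r. y (r div n) $ (r mod n))"
    have z: "z \<in> carrier_vec (k * n)" unfolding z_def by simp
    have "(block_mat k n X *\<^sub>v z) \<bullet>c z = ?Q y"
      using y by (intro main[OF z]) (auto simp: z_def idx)
    then show "0 \<le> ?Q y" using ps z unfolding pos_semidef_def by metis
  next
    assume *: "\<forall>y. ?C y \<longrightarrow> 0 \<le> ?Q y"
    show "pos_semidef (k * n) (block_mat k n X)"
      unfolding pos_semidef_def
    proof (intro conjI ballI)
      fix z :: "complex vec" assume z: "z \<in> carrier_vec (k * n)"
      have "(block_mat k n X *\<^sub>v z) \<bullet>c z = ?Q (\<lambda>i. vec n (\<lambda>r. z $ (i * n + r)))"
        by (intro main[OF z]) auto
      also have "0 \<le> \<dots>" using * by simp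
      finally show "0 \<le> (block_mat k n X *\<^sub>v z) \<bullet>c z" by simp
    qed (simp add: block_mat_def)
  qed
qed

text \<open>For block indices 0 and 1 this is [[1, A], [B, 1]]. B is a separate argument because the
  image under a completely positive map has B = psi(U') for the adjoint U' of U, and that B is the
  adjoint of A = psi(U) is a conclusion drawn from positivity.\<close>

definition dilation_block :: "nat \<Rightarrow> complex mat \<Rightarrow> complex mat \<Rightarrow> nat \<Rightarrow> nat \<Rightarrow> complex mat" where
  "dilation_block n A B i j = (if i = j then 1\<^sub>m n else if i = 0 then A else B)"

lemma pos_semidef_dilation_block_iff:
  assumes "A \<in> carrier_mat n n" "B \<in> carrier_mat n n"
  shows "pos_semidef (2 * n) (block_mat 2 n (dilation_block n A B)) \<longleftrightarrow>
    (\<forall>x y. x \<in> carrier_vec n \<longrightarrow> y \<in> carrier_vec n \<longrightarrow>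
      0 \<le> x \<bullet>c x + (A *\<^sub>v y) \<bullet>c x + ((B *\<^sub>v x) \<bullet>c y + y \<bullet>c y))" (is "_ \<longleftrightarrow> ?R")
proof -
  have two: "{..<2::nat} = {0, 1}" by auto
  have "pos_semidef (2 * n) (block_mat 2 n (dilation_block n A B)) \<longleftrightarrow>
    (\<forall>y. (\<forall>i<2. y i \<in> carrier_vec n) \<longrightarrow>
      0 \<le> (\<Sum>i<2. \<Sum>j<2. (dilation_block n A B i j *\<^sub>v y j) \<bullet>c y i))" (is "_ \<longleftrightarrow> ?M")
    by (rule pos_semidef_block_mat_iff) (use assms in \<open>auto simp: dilation_block_def\<close>)
  also have "?M \<longleftrightarrow> ?R"
  proof (intro iffI allI impI)
    fix x y :: "complex vec" assume M: ?M and xy: "x \<in> carrier_vec n" "y \<in> carrier_vec n"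
    show "0 \<le> x \<bullet>c x + (A *\<^sub>v y) \<bullet>c x + ((B *\<^sub>v x) \<bullet>c y + y \<bullet>c y)"
      using M[rule_format, of "\<lambda>i. if i = 0 then x else y"] xy
      by (simp add: two dilation_block_def add_ac)
  next
    fix y :: "nat \<Rightarrow> complex vec" assume R: ?R and y: "\<forall>i<2. y i \<in> carrier_vec n"
    have "y 0 \<in> carrier_vec n" "y 1 \<in> carrier_vec n" using y by auto
    then show "0 \<le> (\<Sum>i<2. \<Sum>j<2. (dilation_block n A B i j *\<^sub>v y j) \<bullet>c y i)"
      using R[rule_format, of "y 0" "y 1"] by (simp add: two dilation_block_def add_ac)
  qed
  finally show ?thesis .
qed

text \<open>In the complex order a nonnegative form is real. The diagonal terms are real by
  themselves, so the two cross terms have a real sum for every pair of test vectors.\<close>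

lemma adjoint_of_pos_semidef_dilation_block:
  assumes A: "A \<in> carrier_mat n n" and B: "B \<in> carrier_mat n n"
    and ps: "pos_semidef (2 * n) (block_mat 2 n (dilation_block n A B))"
  shows "B = mat_adjoint A"
proof (rule mat_eqI_cscalar_prod[OF B])
  show "mat_adjoint A \<in> carrier_mat n n" using A by simp
  fix x y :: "complex vec" assume x: "x \<in> carrier_vec n" and y: "y \<in> carrier_vec n"
  note ge = ps[unfolded pos_semidef_dilation_block_iff[OF A B], rule_format]
  have real: "Im ((A *\<^sub>v y) \<bullet>c w + (B *\<^sub>v w) \<bullet>c y) = 0" if w: "w \<in> carrier_vec n" for w
    using ge[OF w y] conjugate_square_ge_0_vec[of w] conjugate_square_ge_0_vec[of y] by (simp add: less_eq_complex_def)
  \<comment> \<open>Testing with x compares the imaginary parts of the cross terms; testing with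
    \<open>\<i>\<close> times x compares their real parts.\<close>
  have "\<i> \<cdot>\<^sub>v x \<in> carrier_vec n" using x by simp
  from real[OF this] have "Re ((A *\<^sub>v y) \<bullet>c x) = Re ((B *\<^sub>v x) \<bullet>c y)"
    using A B x y by (simp add: mult_mat_vec[of _ n n] cscalar_prod_smult[of _ n] mult_mat_vec_carrier[of _ n n])
  moreover have "Im ((A *\<^sub>v y) \<bullet>c x) = - Im ((B *\<^sub>v x) \<bullet>c y)"
    using real[OF x] by simp
  ultimately have "(B *\<^sub>v x) \<bullet>c y = cnj ((A *\<^sub>v y) \<bullet>c x)"
    by (simp add: complex_eq_iff)
  also have "\<dots> = x \<bullet>c (A *\<^sub>v y)" using A x y by (intro cnj_cscalar_prod[of _ n]) auto
  also have "\<dots> = (mat_adjoint A *\<^sub>v x) \<bullet>c y" using A x y by (simp add: cscalar_prod_adjoint')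
  finally show "(B *\<^sub>v x) \<bullet>c y = (mat_adjoint A *\<^sub>v x) \<bullet>c y" .
qed

text \<open>As B is the adjoint of A, the form at (x, y) is |x + A y|^2 + |y|^2 - |A y|^2, so x = -
  A y is the optimal test vector.\<close>

lemma contraction_of_pos_semidef_dilation_block:
  assumes A: "A \<in> carrier_mat n n" and B: "B \<in> carrier_mat n n"
    and ps: "pos_semidef (2 * n) (block_mat 2 n (dilation_block n A B))"
    and y: "y \<in> carrier_vec n"
  shows "(A *\<^sub>v y) \<bullet>c (A *\<^sub>v y) \<le> y \<bullet>c y"
proof -
  note ge = ps[unfolded pos_semidef_dilation_block_iff[OF A B], rule_format]
  define w where "w = A *\<^sub>v y"
  have w: "w \<in> carrier_vec n" unfolding w_def using A y by simp
  have m: "(-1) \<cdot>\<^sub>v w \<in> carrier_vec n" using w by simp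
  have Bw: "(B *\<^sub>v w) \<bullet>c y = w \<bullet>c w"
    unfolding adjoint_of_pos_semidef_dilation_block[OF A B ps] using w y A
    by (simp add: cscalar_prod_adjoint' w_def)
  have "0 \<le> ((-1) \<cdot>\<^sub>v w) \<bullet>c ((-1) \<cdot>\<^sub>v w) + w \<bullet>c ((-1) \<cdot>\<^sub>v w) + ((B *\<^sub>v ((-1) \<cdot>\<^sub>v w)) \<bullet>c y + y \<bullet>c y)"
    using ge[OF m y] by (simp add: w_def)
  also have "\<dots> = y \<bullet>c y - w \<bullet>c w"
    using w y B by (simp add: mult_mat_vec[of _ n n] cscalar_prod_smult[of _ n] Bw mult_mat_vec_carrier[of _ n n] del: smult_scalar_prod_distrib scalar_prod_smult_distrib)
  finally show ?thesis unfolding w_def by simp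
qed

text \<open>The form at (x, y) is the perfect square |x + U y|^2, because |U y| = |y|.\<close>

lemma pos_semidef_dilation_block_isometry:
  assumes U: "U \<in> carrier_mat n n" "mat_adjoint U * U = 1\<^sub>m n"
  shows "pos_semidef (2 * n) (block_mat 2 n (dilation_block n U (mat_adjoint U)))"
proof (subst pos_semidef_dilation_block_iff; (intro allI impI)?)
  fix x y :: "complex vec" assume x: "x \<in> carrier_vec n" and y: "y \<in> carrier_vec n"
  define z where "z = U *\<^sub>v y"
  have z: "z \<in> carrier_vec n" unfolding z_def using U y by simp
  have zz: "z \<bullet>c z = y \<bullet>c y" unfolding z_def by (rule isometry_cscalar_prod[OF U y])
  have "(mat_adjoint U *\<^sub>v x) \<bullet>c y = x \<bullet>c z"
    unfolding z_def using U x y by (simp add: cscalar_prod_adjoint')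
  then have "x \<bullet>c x + (U *\<^sub>v y) \<bullet>c x + ((mat_adjoint U *\<^sub>v x) \<bullet>c y + y \<bullet>c y) =
    (x - (-1) \<cdot>\<^sub>v z) \<bullet>c (x - (-1) \<cdot>\<^sub>v z)"
    using x z by (simp add: z_def[symmetric] zz[symmetric] minus_scalar_prod_distrib[of _ n]
      cscalar_prod_minus_right[of _ n] cscalar_prod_smult[of _ n] del: smult_scalar_prod_distrib scalar_prod_smult_distrib)
  then show "0 \<le> x \<bullet>c x + (U *\<^sub>v y) \<bullet>c x + ((mat_adjoint U *\<^sub>v x) \<bullet>c y + y \<bullet>c y)"
    by (simp add: conjugate_square_ge_0_vec)
qed (use U in auto)

section \<open>Unital completely positive maps and matrix ranges\<close>

lemma op_system_mem:
  assumes z: "z \<in> mtuples g d"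
  shows "1\<^sub>m d \<in> op_system d z" "set z \<subseteq> op_system d z" "mat_adjoint ` set z \<subseteq> op_system d z"
proof -
  interpret Module.module class_ring "module_mat TYPE(complex) d d" by (rule module_module_mat)
  have "insert (1\<^sub>m d) (set z \<union> mat_adjoint ` set z) \<subseteq> op_system d z"
    unfolding op_system_def using z
    by (intro in_own_span) (auto simp: module_mat_simps mtuples_def)
  then show "1\<^sub>m d \<in> op_system d z" "set z \<subseteq> op_system d z" "mat_adjoint ` set z \<subseteq> op_system d z"
    by auto
qed

lemma ucp_map_carrier: "ucp_map d S n \<psi> \<Longrightarrow> x \<in> S \<Longrightarrow> \<psi> x \<in> carrier_mat n n"
  unfolding ucp_map_def by auto

text \<open>All entries of the block matrix lie in the domain S, so complete positivity at level 2
  applies; unitality keeps the diagonal blocks equal to 1.\<close>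

lemma ucp_map_dilation_block:
  assumes ucp: "ucp_map d S n \<psi>" and S: "1\<^sub>m d \<in> S" "U \<in> S" "mat_adjoint U \<in> S"
    and U: "U \<in> carrier_mat d d" "mat_adjoint U * U = 1\<^sub>m d"
  shows "pos_semidef (2 * n) (block_mat 2 n (dilation_block n (\<psi> U) (\<psi> (mat_adjoint U))))"
proof -
  let ?X = "dilation_block d U (mat_adjoint U)"
  have "pos_semidef (2 * n) (block_mat 2 n (\<lambda>i j. \<psi> (?X i j)))"
  proof -
    have "\<forall>i<2. \<forall>j<2. ?X i j \<in> S" using S by (simp add: dilation_block_def)
    with ucp pos_semidef_dilation_block_isometry[OF U]
    show ?thesis unfolding ucp_map_def by (metis zero_less_numeral)
  qed
  also have "(\<lambda>i j. \<psi> (?X i j)) = dilation_block n (\<psi> U) (\<psi> (mat_adjoint U))"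
    using ucp unfolding ucp_map_def by (auto simp: dilation_block_def fun_eq_iff)
  finally show ?thesis .
qed

text \<open>The block argument is run for U and again for its adjoint, which is also an isometry;
  the first claim then rewrites the second run in terms of the adjoint of
  \<open>\<psi> U\<close>.\<close>

lemma ucp_map_unitary:
  assumes ucp: "ucp_map d S n \<psi>" and S: "1\<^sub>m d \<in> S" "U \<in> S" "mat_adjoint U \<in> S"
    and U: "unitary d U"
  shows "\<psi> (mat_adjoint U) = mat_adjoint (\<psi> U)"
    and "y \<in> carrier_vec n \<Longrightarrow> (\<psi> U *\<^sub>v y) \<bullet>c (\<psi> U *\<^sub>v y) \<le> y \<bullet>c y"
    and "y \<in> carrier_vec n \<Longrightarrow> (mat_adjoint (\<psi> U) *\<^sub>v y) \<bullet>c (mat_adjoint (\<psi> U) *\<^sub>v y) \<le> y \<bullet>c y"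
proof -
  have Uc: "U \<in> carrier_mat d d" "mat_adjoint U * U = 1\<^sub>m d"
    "mat_adjoint U \<in> carrier_mat d d" "mat_adjoint (mat_adjoint U) * mat_adjoint U = 1\<^sub>m d"
    using U by (auto simp: unitary_def)
  note c = ucp_map_carrier[OF ucp S(2)] ucp_map_carrier[OF ucp S(3)]
  note ps = ucp_map_dilation_block[OF ucp S Uc(1,2)]
  show adj: "\<psi> (mat_adjoint U) = mat_adjoint (\<psi> U)"
    by (rule adjoint_of_pos_semidef_dilation_block[OF c ps])
  show "(\<psi> U *\<^sub>v y) \<bullet>c (\<psi> U *\<^sub>v y) \<le> y \<bullet>c y" if "y \<in> carrier_vec n"
    by (rule contraction_of_pos_semidef_dilation_block[OF c ps that])
  have "mat_adjoint (mat_adjoint U) \<in> S" using S by simp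
  note ps' = ucp_map_dilation_block[OF ucp S(1,3) this Uc(3,4)]
  show "(mat_adjoint (\<psi> U) *\<^sub>v y) \<bullet>c (mat_adjoint (\<psi> U) *\<^sub>v y) \<le> y \<bullet>c y" if "y \<in> carrier_vec n"
    using contraction_of_pos_semidef_dilation_block[OF c(2) _ ps' that] c(1) adj by simp
qed

section \<open>Matrix ranges and their matrix convexity\<close>

lemma ucp_map_id:
  assumes "S \<subseteq> carrier_mat d d"
  shows "ucp_map d S d (\<lambda>x. x)"
  using assms by (auto simp: ucp_map_def)

lemma op_system_subset:
  assumes z: "z \<in> mtuples g d"
  shows "op_system d z \<subseteq> carrier_mat d d"
proof -
  interpret Module.module class_ring "module_mat TYPE(complex) d d" by (rule module_module_mat)
  have "op_system d z \<subseteq> carrier (module_mat TYPE(complex) d d)"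
    unfolding op_system_def using z
    by (intro span_is_subset2) (auto simp: module_mat_simps mtuples_def)
  then show ?thesis by (simp add: module_mat_simps)
qed

lemma mem_matrix_range_self: "z \<in> mtuples g d \<Longrightarrow> z \<in> matrix_range d z d"
  unfolding matrix_range_def using ucp_map_id[OF op_system_subset, of z g d]
  by (auto intro!: exI[of _ "\<lambda>x. x"])

lemma matrix_range_subset: "z \<in> mtuples g d \<Longrightarrow> matrix_range d z n \<subseteq> mtuples g n"
  using op_system_mem(2)[of z g d]
  by (auto simp: matrix_range_def mtuples_def) (metis subsetD ucp_map_carrier)

text \<open>The block form of the combined map at vectors y i is the sum over j of the block forms
  of \<open>\<psi> j\<close> at the vectors \<open>\<gamma> j *\<^sub>v y i\<close>, hence
  nonnegative. Unitality is the normalisation of the coefficients.\<close>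

lemma ucp_map_convex_comb:
  assumes \<gamma>: "convex_coeffs n m N \<gamma>"
    and ucp: "\<And>j. j < m \<Longrightarrow> ucp_map d S (N j) (\<psi> j)"
  shows "ucp_map d S n (\<lambda>x. mat_sum n (\<lambda>j. mat_adjoint (\<gamma> j) * \<psi> j x * \<gamma> j) m)"
    (is "ucp_map d S n ?\<phi>")
proof -
  have \<gamma>c: "\<gamma> j \<in> carrier_mat (N j) n" if "j < m" for j
    using \<gamma> that by (auto simp: convex_coeffs_def)
  have \<psi>c: "\<psi> j x \<in> carrier_mat (N j) (N j)" if "j < m" "x \<in> S" for j x
    using ucp_map_carrier[OF ucp] that by blast
  have cc: "mat_adjoint (\<gamma> j) * \<psi> j x * \<gamma> j \<in> carrier_mat n n" if "j < m" "x \<in> S" for j x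
    using compress_carrier[OF \<gamma>c \<psi>c] that by blast
  have \<phi>c: "?\<phi> x \<in> carrier_mat n n" if "x \<in> S" for x
    using cc that by simp
  have quad: "(?\<phi> x *\<^sub>v v) \<bullet>c w = (\<Sum>j<m. (\<psi> j x *\<^sub>v (\<gamma> j *\<^sub>v v)) \<bullet>c (\<gamma> j *\<^sub>v w))"
    if "x \<in> S" "v \<in> carrier_vec n" "w \<in> carrier_vec n" for x v w
    using that by (intro cscalar_prod_compress_sum[where N = N] \<gamma>c \<psi>c) auto
  show ?thesis
    unfolding ucp_map_def
  proof (intro conjI ballI allI impI)
    show "?\<phi> \<in> S \<rightarrow> carrier_mat n n" using \<phi>c by blast
    show "?\<phi> (x + y) = ?\<phi> x + ?\<phi> y" if xy: "x \<in> S" "y \<in> S" for x y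
    proof -
      have "?\<phi> (x + y) = mat_sum n (\<lambda>j. mat_adjoint (\<gamma> j) * \<psi> j x * \<gamma> j + mat_adjoint (\<gamma> j) * \<psi> j y * \<gamma> j) m"
      proof (rule mat_sum_cong)
        fix j assume j: "j < m"
        have "\<psi> j (x + y) = \<psi> j x + \<psi> j y" using ucp[OF j] xy by (simp add: ucp_map_def)
        then show "mat_adjoint (\<gamma> j) * \<psi> j (x + y) * \<gamma> j =
          mat_adjoint (\<gamma> j) * \<psi> j x * \<gamma> j + mat_adjoint (\<gamma> j) * \<psi> j y * \<gamma> j"
          using \<gamma>c[OF j] \<psi>c[OF j] xy mat_adjoint_carrier[OF \<gamma>c[OF j]]
          by (simp add: mult_add_distrib_mat[of _ n "N j" _ "N j"]
              add_mult_distrib_mat[of _ n "N j" _ _ n] mult_carrier_mat[of _ n "N j" _ "N j"])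
        show "mat_adjoint (\<gamma> j) * \<psi> j x * \<gamma> j + mat_adjoint (\<gamma> j) * \<psi> j y * \<gamma> j \<in> carrier_mat n n"
          using cc j xy by simp
      qed
      also have "\<dots> = ?\<phi> x + ?\<phi> y"
        by (rule mat_sum_add) (use cc xy in auto)
      finally show ?thesis .
    qed
    show "?\<phi> (c \<cdot>\<^sub>m x) = c \<cdot>\<^sub>m ?\<phi> x" if x: "x \<in> S" for c x
    proof -
      have "?\<phi> (c \<cdot>\<^sub>m x) = mat_sum n (\<lambda>j. c \<cdot>\<^sub>m (mat_adjoint (\<gamma> j) * \<psi> j x * \<gamma> j)) m"
      proof (rule mat_sum_cong)
        fix j assume j: "j < m"
        have "\<psi> j (c \<cdot>\<^sub>m x) = c \<cdot>\<^sub>m \<psi> j x" using ucp[OF j] x by (simp add: ucp_map_def)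
        then show "mat_adjoint (\<gamma> j) * \<psi> j (c \<cdot>\<^sub>m x) * \<gamma> j = c \<cdot>\<^sub>m (mat_adjoint (\<gamma> j) * \<psi> j x * \<gamma> j)"
          using \<gamma>c[OF j] \<psi>c[OF j x] mat_adjoint_carrier[OF \<gamma>c[OF j]]
          by (simp add: mult_smult_distrib[of _ n "N j" _ "N j"]
              mult_smult_assoc_mat[of _ n "N j" _ n] mult_carrier_mat[of _ n "N j" _ "N j"])
        show "c \<cdot>\<^sub>m (mat_adjoint (\<gamma> j) * \<psi> j x * \<gamma> j) \<in> carrier_mat n n"
          using cc j x by simp
      qed
      also have "\<dots> = c \<cdot>\<^sub>m ?\<phi> x"
        by (rule mat_sum_smult) (use cc x in auto)
      finally show ?thesis .
    qed
    have "?\<phi> (1\<^sub>m d) = mat_sum n (\<lambda>j. mat_adjoint (\<gamma> j) * \<gamma> j) m"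
    proof (rule mat_sum_cong)
      fix j assume j: "j < m"
      have "\<psi> j (1\<^sub>m d) = 1\<^sub>m (N j)" using ucp[OF j] by (simp add: ucp_map_def)
      then show "mat_adjoint (\<gamma> j) * \<psi> j (1\<^sub>m d) * \<gamma> j = mat_adjoint (\<gamma> j) * \<gamma> j"
        using \<gamma>c[OF j] by (simp add: right_mult_one_mat[of _ n])
      show "mat_adjoint (\<gamma> j) * \<gamma> j \<in> carrier_mat n n"
        using \<gamma>c[OF j] by (auto intro: mult_carrier_mat)
    qed
    then show "?\<phi> (1\<^sub>m d) = 1\<^sub>m n" using \<gamma> by (simp add: convex_coeffs_def)
  next
    fix k :: nat and X
    assume k: "0 < k" and "(\<forall>i<k. \<forall>j<k. X i j \<in> S) \<and> pos_semidef (k * d) (block_mat k d X)"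
    then have X: "\<And>i j. i < k \<Longrightarrow> j < k \<Longrightarrow> X i j \<in> S"
      and ps: "pos_semidef (k * d) (block_mat k d X)" by auto
    have "\<forall>y. (\<forall>i<k. y i \<in> carrier_vec n) \<longrightarrow>
      0 \<le> (\<Sum>i<k. \<Sum>l<k. (?\<phi> (X i l) *\<^sub>v y l) \<bullet>c y i)"
    proof (intro allI impI)
      fix y :: "nat \<Rightarrow> complex vec" assume y: "\<forall>i<k. y i \<in> carrier_vec n"
      have "(\<Sum>i<k. \<Sum>l<k. (?\<phi> (X i l) *\<^sub>v y l) \<bullet>c y i) =
        (\<Sum>i<k. \<Sum>l<k. \<Sum>j<m. (\<psi> j (X i l) *\<^sub>v (\<gamma> j *\<^sub>v y l)) \<bullet>c (\<gamma> j *\<^sub>v y i))"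
        using X y by (intro sum.cong refl quad) auto
      also have "\<dots> = (\<Sum>j<m. \<Sum>i<k. \<Sum>l<k. (\<psi> j (X i l) *\<^sub>v (\<gamma> j *\<^sub>v y l)) \<bullet>c (\<gamma> j *\<^sub>v y i))"
      proof -
        have "(\<Sum>i<k. \<Sum>l<k. \<Sum>j<m. f i l j) = (\<Sum>j<m. \<Sum>i<k. \<Sum>l<k. f i l j)"
          for f :: "nat \<Rightarrow> nat \<Rightarrow> nat \<Rightarrow> complex"
        proof -
          have "(\<Sum>i<k. \<Sum>l<k. \<Sum>j<m. f i l j) = (\<Sum>i<k. \<Sum>j<m. \<Sum>l<k. f i l j)"
            by (intro sum.cong refl sum.swap)
          also have "\<dots> = (\<Sum>j<m. \<Sum>i<k. \<Sum>l<k. f i l j)" by (rule sum.swap)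
          finally show ?thesis .
        qed
        then show ?thesis .
      qed
      also have "\<dots> \<ge> 0"
      proof (rule sum_nonneg)
        fix j assume "j \<in> {..<m}"
        then have j: "j < m" by simp
        have cp: "\<forall>k>0. \<forall>X. (\<forall>i<k. \<forall>l<k. X i l \<in> S) \<and> pos_semidef (k * d) (block_mat k d X) \<longrightarrow>
            pos_semidef (k * N j) (block_mat k (N j) (\<lambda>i l. \<psi> j (X i l)))"
          using ucp[OF j] unfolding ucp_map_def by (elim conjE)
        have "pos_semidef (k * N j) (block_mat k (N j) (\<lambda>i l. \<psi> j (X i l)))"
          by (rule cp[rule_format, OF k]) (use X ps in simp)
        then have quad_j: "\<forall>y. (\<forall>i<k. y i \<in> carrier_vec (N j)) \<longrightarrow>
            0 \<le> (\<Sum>i<k. \<Sum>l<k. (\<psi> j (X i l) *\<^sub>v y l) \<bullet>c y i)"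
          by (rule pos_semidef_block_mat_iff[THEN iffD1, rotated]) (rule \<psi>c[OF j X])
        have y_j: "\<forall>i<k. \<gamma> j *\<^sub>v y i \<in> carrier_vec (N j)"
          using \<gamma>c[OF j] y by auto
        show "0 \<le> (\<Sum>i<k. \<Sum>l<k. (\<psi> j (X i l) *\<^sub>v (\<gamma> j *\<^sub>v y l)) \<bullet>c (\<gamma> j *\<^sub>v y i))"
          by (rule mp[OF spec[OF quad_j, of "\<lambda>i. \<gamma> j *\<^sub>v y i"] y_j])
      qed
      finally show "0 \<le> (\<Sum>i<k. \<Sum>l<k. (?\<phi> (X i l) *\<^sub>v y l) \<bullet>c y i)" .
    qed
    then show "pos_semidef (k * n) (block_mat k n (\<lambda>i j. ?\<phi> (X i j)))"
      by (rule pos_semidef_block_mat_iff[THEN iffD2, rotated]) (rule \<phi>c[OF X])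
  qed
qed

text \<open>The same coefficients act in every coordinate, so a single combined map, evaluated at
  the entries of z, produces the whole combination.\<close>

lemma matrix_convex_matrix_range:
  assumes z: "z \<in> mtuples g d"
  shows "matrix_convex g (matrix_range d z)"
  unfolding matrix_convex_def
proof (intro conjI allI impI)
  show "matrix_range d z n \<subseteq> mtuples g n" for n by (rule matrix_range_subset[OF z])
  fix n m :: nat and N a \<gamma>
  assume *: "(\<forall>j<m. N j > 0 \<and> a j \<in> matrix_range d z (N j)) \<and> convex_coeffs n m N \<gamma>"
  then have \<gamma>: "convex_coeffs n m N \<gamma>" by simp
  from * have "\<forall>j<m. \<exists>\<psi>. a j = map \<psi> z \<and> ucp_map d (op_system d z) (N j) \<psi>"
    by (auto simp: matrix_range_def)
  then obtain \<psi> where \<psi>: "\<And>j. j < m \<Longrightarrow> a j = map (\<psi> j) z"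
    "\<And>j. j < m \<Longrightarrow> ucp_map d (op_system d z) (N j) (\<psi> j)" by metis
  have len: "length z = g" using z by (simp add: mtuples_def)
  have "matrix_comb g n m a \<gamma> =
    map (\<lambda>x. mat_sum n (\<lambda>j. mat_adjoint (\<gamma> j) * \<psi> j x * \<gamma> j) m) z"
  proof (rule nth_equalityI)
    fix i assume "i < length (matrix_comb g n m a \<gamma>)"
    then have i: "i < g" by (simp add: matrix_comb_def)
    have zi: "z ! i \<in> op_system d z"
      using op_system_mem(2)[OF z] i len by (auto dest: nth_mem)
    have "mat_sum n (\<lambda>j. compress (\<gamma> j) (a j) ! i) m =
      mat_sum n (\<lambda>j. mat_adjoint (\<gamma> j) * \<psi> j (z ! i) * \<gamma> j) m"
    proof (rule mat_sum_cong)
      fix j assume j: "j < m"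
      show "compress (\<gamma> j) (a j) ! i = mat_adjoint (\<gamma> j) * \<psi> j (z ! i) * \<gamma> j"
        using i len \<psi>(1)[OF j] by (simp add: compress_def)
      show "mat_adjoint (\<gamma> j) * \<psi> j (z ! i) * \<gamma> j \<in> carrier_mat n n"
        using \<gamma> j ucp_map_carrier[OF \<psi>(2)[OF j] zi]
        by (intro compress_carrier[of _ "N j"]) (auto simp: convex_coeffs_def)
    qed
    then show "matrix_comb g n m a \<gamma> ! i =
      map (\<lambda>x. mat_sum n (\<lambda>j. mat_adjoint (\<gamma> j) * \<psi> j x * \<gamma> j) m) z ! i"
      using i len by (simp add: matrix_comb_def)
  qed (simp add: matrix_comb_def len)
  then show "matrix_comb g n m a \<gamma> \<in> matrix_range d z n"
    using ucp_map_convex_comb[OF \<gamma> \<psi>(2)] unfolding matrix_range_def by blast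
qed

section \<open>Irreducible tuples of unitaries\<close>

text \<open>Irreducibility is expressed by the commutant of the entries alone: for a unitary U,
  commuting with U and commuting with its adjoint are the same condition.\<close>

lemma absolute_extreme_point_irreducible_unitaries:
  assumes "0 < n" and b: "b \<in> mtuples g n"
    and unit: "\<And>U. U \<in> set b \<Longrightarrow> unitary n U"
    and irred: "\<And>T. T \<in> carrier_mat n n \<Longrightarrow> (\<And>U. U \<in> set b \<Longrightarrow> T * U = U * T) \<Longrightarrow>
      \<exists>c. T = c \<cdot>\<^sub>m 1\<^sub>m n"
  shows "absolute_extreme_point g (matrix_range n b) n b"
  unfolding absolute_extreme_point_def
proof (intro conjI allI impI)
  show "matrix_convex g (matrix_range n b)" by (rule matrix_convex_matrix_range[OF b])
  show "b \<in> matrix_range n b n" by (rule mem_matrix_range_self[OF b])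
  fix m :: nat and N a \<gamma> j
  assume asm: "(\<forall>j<m. N j > 0 \<and> a j \<in> matrix_range n b (N j) \<and> \<gamma> j \<noteq> 0\<^sub>m (N j) n) \<and>
    convex_coeffs n m N \<gamma> \<and> b = matrix_comb g n m a \<gamma>" and j: "j < m"
  have \<gamma>: "\<gamma> j \<in> carrier_mat (N j) n" if "j < m" for j
    using asm that by (auto simp: convex_coeffs_def)
  have one: "mat_sum n (\<lambda>j. mat_adjoint (\<gamma> j) * \<gamma> j) m = 1\<^sub>m n"
    using asm by (simp add: convex_coeffs_def)
  from asm have "\<forall>j<m. \<exists>\<psi>. a j = map \<psi> b \<and> ucp_map n (op_system n b) (N j) \<psi>"
    by (auto simp: matrix_range_def)
  then obtain \<psi> where \<psi>: "\<And>j. j < m \<Longrightarrow> a j = map (\<psi> j) b"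
    "\<And>j. j < m \<Longrightarrow> ucp_map n (op_system n b) (N j) (\<psi> j)" by metis
  have aj: "a j \<in> mtuples g (N j)" using matrix_range_subset[OF b] asm j by blast
  have len: "length b = g" using b by (simp add: mtuples_def)
  have inter: "a j ! i * \<gamma> j = \<gamma> j * b ! i \<and>
      mat_adjoint (a j ! i) * \<gamma> j = \<gamma> j * mat_adjoint (b ! i)" if i: "i < g" for i
  proof -
    define U where "U = b ! i"
    have Ub: "U \<in> set b" unfolding U_def using i len by simp
    then have S: "1\<^sub>m n \<in> op_system n b" "U \<in> op_system n b" "mat_adjoint U \<in> op_system n b"
      using op_system_mem[OF b] by auto
    have U: "unitary n U" by (rule unit[OF Ub])
    have Uc: "U \<in> carrier_mat n n" "mat_adjoint U * U = 1\<^sub>m n"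
      "mat_adjoint U \<in> carrier_mat n n" "mat_adjoint (mat_adjoint U) * mat_adjoint U = 1\<^sub>m n"
      using U by (auto simp: unitary_def)
    \<comment> \<open>Here and in the next facts j ranges over all indices: equality in the chosen
      summand comes from an estimate of the whole sum.\<close>
    have X: "\<psi> j U \<in> carrier_mat (N j) (N j)" if "j < m" for j
      using ucp_map_carrier[OF \<psi>(2)[OF that] S(2)] .
    have cc: "mat_adjoint (\<gamma> j) * \<psi> j U * \<gamma> j \<in> carrier_mat n n" if "j < m" for j
      using compress_carrier[OF \<gamma> X] that by blast
    have "U = matrix_comb g n m a \<gamma> ! i" using asm U_def by simp
    also have "\<dots> = mat_sum n (\<lambda>j. compress (\<gamma> j) (a j) ! i) m"
      using i by (simp add: matrix_comb_def)
    also have "\<dots> = mat_sum n (\<lambda>j. mat_adjoint (\<gamma> j) * \<psi> j U * \<gamma> j) m"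
      using cc i len \<psi>(1) by (intro mat_sum_cong) (auto simp: compress_def U_def)
    finally have comb: "mat_sum n (\<lambda>j. mat_adjoint (\<gamma> j) * \<psi> j U * \<gamma> j) m = U" by simp
    \<comment> \<open>Taking adjoints represents the adjoint of U by the same coefficients, so the
      intertwining lemma can be applied a second time.\<close>
    have "mat_adjoint U = mat_sum n (\<lambda>j. mat_adjoint (mat_adjoint (\<gamma> j) * \<psi> j U * \<gamma> j)) m"
      using mat_adjoint_mat_sum[of m "\<lambda>j. mat_adjoint (\<gamma> j) * \<psi> j U * \<gamma> j" n] cc
      by (simp only: comb)
    also have "\<dots> = mat_sum n (\<lambda>j. mat_adjoint (\<gamma> j) * mat_adjoint (\<psi> j U) * \<gamma> j) m"
    proof (rule mat_sum_cong)
      fix j assume j: "j < m"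
      have "mat_adjoint (\<gamma> j) \<in> carrier_mat n (N j)" using \<gamma>[OF j] by simp
      then show "mat_adjoint (mat_adjoint (\<gamma> j) * \<psi> j U * \<gamma> j) =
        mat_adjoint (\<gamma> j) * mat_adjoint (\<psi> j U) * \<gamma> j"
        using \<gamma>[OF j] X[OF j]
        by (simp add: mat_adjoint_mult[of _ n "N j" _ n] mat_adjoint_mult[of _ n "N j" _ "N j"]
            mat_adjoint_mult[of _ "N j" "N j" _ n] mult_carrier_mat[of _ _ "N j"]
            assoc_mult_mat[of _ n "N j" _ "N j" _ n])
      show "mat_adjoint (\<gamma> j) * mat_adjoint (\<psi> j U) * \<gamma> j \<in> carrier_mat n n"
        using \<gamma>[OF j] X[OF j] by (intro compress_carrier[of _ "N j"]) auto
    qed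
    finally have comb': "mat_sum n (\<lambda>j. mat_adjoint (\<gamma> j) * mat_adjoint (\<psi> j U) * \<gamma> j) m = mat_adjoint U"
      by simp
    have "\<psi> j U * \<gamma> j = \<gamma> j * U"
    proof (rule intertwine_of_contraction[where X = "\<lambda>j. \<psi> j U" and \<gamma> = \<gamma> and N = N and m = m and j = j])
      show "(\<psi> j U *\<^sub>v y) \<bullet>c (\<psi> j U *\<^sub>v y) \<le> y \<bullet>c y" if "j < m" "y \<in> carrier_vec (N j)" for j y
        by (rule ucp_map_unitary(2)[OF \<psi>(2)[OF that(1)] S U that(2)])
    qed (fact Uc \<gamma> X one comb j)+
    moreover have "mat_adjoint (\<psi> j U) * \<gamma> j = \<gamma> j * mat_adjoint U"
    proof (rule intertwine_of_contraction[where X = "\<lambda>j. mat_adjoint (\<psi> j U)" and \<gamma> = \<gamma> and N = N and m = m and j = j])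
      show "mat_adjoint (\<psi> j U) \<in> carrier_mat (N j) (N j)" if "j < m" for j
        using X[OF that] by simp
      show "(mat_adjoint (\<psi> j U) *\<^sub>v y) \<bullet>c (mat_adjoint (\<psi> j U) *\<^sub>v y) \<le> y \<bullet>c y"
        if "j < m" "y \<in> carrier_vec (N j)" for j y
        by (rule ucp_map_unitary(3)[OF \<psi>(2)[OF that(1)] S U that(2)])
    qed (fact Uc \<gamma> one comb' j)+
    moreover have "a j ! i = \<psi> j U" using \<psi>(1)[OF j] i len by (simp add: U_def)
    ultimately show ?thesis by (simp add: U_def)
  qed
  define T where "T = mat_adjoint (\<gamma> j) * \<gamma> j"
  note \<gamma>j = \<gamma>[OF j]
  have \<gamma>j': "mat_adjoint (\<gamma> j) \<in> carrier_mat n (N j)" using \<gamma>j by simp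
  have T: "T \<in> carrier_mat n n" unfolding T_def using \<gamma>j \<gamma>j' by auto
  have "T * U = U * T" if U: "U \<in> set b" for U
  proof -
    obtain i where i: "i < g" "U = b ! i" using U len by (auto simp: in_set_conv_nth)
    have Uc: "U \<in> carrier_mat n n" "mat_adjoint U \<in> carrier_mat n n"
      using unit[OF U] by (auto simp: unitary_def)
    have ai: "a j ! i \<in> carrier_mat (N j) (N j)" using mtuples_nth[OF aj i(1)] .
    have "T * U = mat_adjoint (\<gamma> j) * (a j ! i * \<gamma> j)"
      using inter[OF i(1)] i(2) \<gamma>j \<gamma>j' Uc(1)
      by (simp add: T_def assoc_mult_mat[of _ n "N j" _ n _ n])
    \<comment> \<open>Regrouping puts the adjoint of \<open>a j ! i\<close> next to
      \<open>\<gamma> j\<close>, where the second intertwining relation takes over.\<close>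
    also have "\<dots> = mat_adjoint (mat_adjoint (a j ! i) * \<gamma> j) * \<gamma> j"
      using \<gamma>j \<gamma>j' ai
      by (simp add: mat_adjoint_mult[of _ "N j" "N j" _ n] assoc_mult_mat[of _ n "N j" _ "N j" _ n])
    also have "\<dots> = U * T"
      using inter[OF i(1)] i(2) \<gamma>j \<gamma>j' Uc
      by (simp add: T_def mat_adjoint_mult[of _ "N j" n _ n] assoc_mult_mat[of _ n n _ "N j" _ n])
    finally show ?thesis .
  qed
  from irred[OF T this] obtain c where c: "T = c \<cdot>\<^sub>m 1\<^sub>m n" by blast
  have quad: "(\<gamma> j *\<^sub>v v) \<bullet>c (\<gamma> j *\<^sub>v v) = c * (v \<bullet>c v)" if v: "v \<in> carrier_vec n" for v
  proof -
    have "c * (v \<bullet>c v) = (c \<cdot>\<^sub>v v) \<bullet>c v" using v by (simp add: cscalar_prod_smult[of _ n])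
    also have "c \<cdot>\<^sub>v v = T *\<^sub>v v" using v by (intro eq_vecI) (auto simp: c smult_scalar_prod_distrib[of _ n])
    also have "\<dots> = mat_adjoint (\<gamma> j) *\<^sub>v (\<gamma> j *\<^sub>v v)" using v \<gamma>j \<gamma>j'
      by (simp add: T_def assoc_mult_mat_vec[of _ n "N j" _ n])
    also have "\<dots> \<bullet>c v = (\<gamma> j *\<^sub>v v) \<bullet>c (\<gamma> j *\<^sub>v v)"
      using v \<gamma>j by (intro cscalar_prod_adjoint'[of _ "N j" n]) auto
    finally show ?thesis by simp
  qed
  have "c \<noteq> 0"
  proof
    assume "c = 0"
    have "\<gamma> j = 0\<^sub>m (N j) n"
    proof (rule mat_eqI_mult_vec[OF \<gamma>j])
      fix v :: "complex vec" assume v: "v \<in> carrier_vec n"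
      have "\<gamma> j *\<^sub>v v = 0\<^sub>v (N j)"
        using quad[OF v] \<open>c = 0\<close> \<gamma>j v conjugate_square_eq_0_vec[of "\<gamma> j *\<^sub>v v" "N j"] by simp
      then show "\<gamma> j *\<^sub>v v = 0\<^sub>m (N j) n *\<^sub>v v" using v by (intro eq_vecI) auto
    qed simp
    with asm j show False by blast
  qed
  moreover have "0 \<le> c"
  proof -
    \<comment> \<open>A unit vector exists since n > 0; at it, \<open>quad\<close> exhibits c as a
      squared norm.\<close>
    have "(unit_vec n 0 :: complex vec) \<bullet>c unit_vec n 0 = 1"
      using \<open>0 < n\<close> by simp
    then show ?thesis
      using quad[of "unit_vec n 0"] conjugate_square_ge_0_vec[of "\<gamma> j *\<^sub>v unit_vec n 0"] by (metis mult.right_neutral unit_vec_carrier)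
  qed
  ultimately have Re: "0 < Re c" "c = complex_of_real (Re c)"
    by (auto simp: less_eq_complex_def complex_eq_iff)
  \<comment> \<open>The factor that turns \<open>\<gamma> j\<close>, which scales squared norms by
    c, into an isometry.\<close>
  define s where "s = complex_of_real (1 / sqrt (Re c))"
  define W where "W = s \<cdot>\<^sub>m \<gamma> j"
  have W: "W \<in> carrier_mat (N j) n" unfolding W_def using \<gamma>j by simp
  have "mat_adjoint W = cnj s \<cdot>\<^sub>m mat_adjoint (\<gamma> j)"
    unfolding W_def using \<gamma>j by (intro eq_matI) auto
  then have "mat_adjoint W * W = s \<cdot>\<^sub>m (cnj s \<cdot>\<^sub>m T)"
    unfolding W_def T_def using \<gamma>j \<gamma>j'
    by (simp add: mult_smult_distrib[of _ n "N j" _ n] mult_smult_assoc_mat[of _ n "N j" _ n])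
  also have "\<dots> = (cnj s * s * c) \<cdot>\<^sub>m 1\<^sub>m n" unfolding c by (intro eq_matI) auto
  also have "cnj s * s * c = 1"
    using Re(1) by (subst Re(2)) (simp add: s_def flip: of_real_mult)
  also have "1 \<cdot>\<^sub>m 1\<^sub>m n = (1\<^sub>m n :: complex mat)" by (intro eq_matI) auto
  finally have WW: "mat_adjoint W * W = 1\<^sub>m n" .
  show "N j = n \<and> unitarily_equiv n (a j) b \<or>
    N j > n \<and> (\<exists>c \<in> mtuples g (N j - n). unitarily_equiv (N j) (a j) (tuple_dsum b c))"
  proof (rule reducing_isometry_cases[OF aj b W WW])
    fix i assume i: "i < g"
    have c: "a j ! i \<in> carrier_mat (N j) (N j)" "b ! i \<in> carrier_mat n n"
      "mat_adjoint (a j ! i) \<in> carrier_mat (N j) (N j)" "mat_adjoint (b ! i) \<in> carrier_mat n n"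
      using mtuples_nth[OF aj i] mtuples_nth[OF b i] by auto
    \<comment> \<open>The intertwining relations are linear in \<open>\<gamma> j\<close>, so they
      survive the rescaling.\<close>
    show "a j ! i * W = W * b ! i" "mat_adjoint (a j ! i) * W = W * mat_adjoint (b ! i)"
      using inter[OF i] c \<gamma>j unfolding W_def
      by (simp_all add: mult_smult_distrib[of _ "N j" "N j" _ n] mult_smult_assoc_mat[of _ "N j" n _ n])
  qed
qed (use \<open>0 < n\<close> in auto)

section \<open>The Weyl unitaries\<close>

lemma unitary_weyl_u:
  assumes "cmod \<zeta> = 1"
  shows "unitary p (weyl_u p \<zeta>)"
proof -
  have "mat_adjoint (weyl_u p \<zeta>) = mat_diag p (\<lambda>i. cnj (\<zeta> ^ i))"
    by (intro eq_matI) (auto simp: weyl_u_def mat_diag_def)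
  moreover have "\<zeta> ^ i * cnj \<zeta> ^ i = 1" "cnj \<zeta> ^ i * \<zeta> ^ i = 1" for i
    using assms complex_norm_square[of "\<zeta> ^ i"] by (simp_all add: norm_power mult.commute)
  ultimately show ?thesis
    unfolding unitary_def weyl_u_def by simp
qed

text \<open>Row i of the shift has its single 1 in column i - 1 modulo p; the case distinction is
  this reduction modulo p for indices starting at 0.\<close>

lemma weyl_v_mult_index:
  assumes "A \<in> carrier_mat p k" "i < p" "j < k"
  shows "(weyl_v p * A) $$ (i, j) = A $$ (if i = 0 then p - 1 else i - 1, j)"
proof -
  let ?l = "if i = 0 then p - 1 else i - 1"
  have "(weyl_v p * A) $$ (i, j) = (\<Sum>l<p. weyl_v p $$ (i, l) * A $$ (l, j))"
    using assms by (auto simp: weyl_v_def scalar_prod_def atLeast0LessThan)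
  also have "\<dots> = (\<Sum>l<p. if l = ?l then A $$ (l, j) else 0)"
    using assms by (intro sum.cong) (auto simp: weyl_v_def)
  also have "\<dots> = A $$ (?l, j)" using assms by (simp add: less_imp_diff_less)
  finally show ?thesis .
qed

text \<open>Column j of the shift has its single 1 in row j + 1 modulo p.\<close>

lemma mult_weyl_v_index:
  assumes "A \<in> carrier_mat k p" "i < k" "j < p"
  shows "(A * weyl_v p) $$ (i, j) = A $$ (i, if j = p - 1 then 0 else j + 1)"
proof -
  let ?l = "if j = p - 1 then 0 else j + 1"
  have "(A * weyl_v p) $$ (i, j) = (\<Sum>l<p. A $$ (i, l) * weyl_v p $$ (l, j))"
    using assms by (auto simp: weyl_v_def scalar_prod_def atLeast0LessThan)
  also have "\<dots> = (\<Sum>l<p. if l = ?l then A $$ (i, l) else 0)"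
    using assms by (intro sum.cong) (auto simp: weyl_v_def)
  also have "\<dots> = A $$ (i, ?l)" using assms by (simp, linarith)
  finally show ?thesis .
qed

lemma unitary_weyl_v: "unitary p (weyl_v p)"
proof -
  have c: "weyl_v p \<in> carrier_mat p p" "mat_adjoint (weyl_v p) \<in> carrier_mat p p"
    by (auto simp: weyl_v_def)
  have "weyl_v p * mat_adjoint (weyl_v p) = 1\<^sub>m p"
  proof (rule eq_matI)
    fix i j assume "i < dim_row (1\<^sub>m p :: complex mat)" "j < dim_col (1\<^sub>m p :: complex mat)"
    then show "(weyl_v p * mat_adjoint (weyl_v p)) $$ (i, j) = 1\<^sub>m p $$ (i, j)"
      using c by (subst weyl_v_mult_index[OF c(2)]) (auto simp: weyl_v_def)
  qed (use c in auto)
  then show ?thesis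
    using c mat_mult_left_right_inverse[OF c] by (simp add: unitary_def)
qed

text \<open>The diagonal entries of \<open>weyl_u\<close> are distinct, so commuting with it forces
  T to be diagonal; commuting with the cyclic shift makes the diagonal constant.\<close>

lemma weyl_commutant:
  assumes inj: "inj_on (\<lambda>i. \<zeta> ^ i) {..<p}"
    and T: "T \<in> carrier_mat p p"
    and u: "T * weyl_u p \<zeta> = weyl_u p \<zeta> * T" and v: "T * weyl_v p = weyl_v p * T"
  shows "T = T $$ (0, 0) \<cdot>\<^sub>m 1\<^sub>m p"
proof -
  have off: "T $$ (i, j) = 0" if "i < p" "j < p" "i \<noteq> j" for i j
  proof -
    have "(T * weyl_u p \<zeta>) $$ (i, j) = (weyl_u p \<zeta> * T) $$ (i, j)" by (simp add: u)
    then have "T $$ (i, j) * \<zeta> ^ j = \<zeta> ^ i * T $$ (i, j)"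
      using T that by (simp add: weyl_u_def mat_diag_mult_left[of _ p p] mat_diag_mult_right[of _ p p])
    moreover have "\<zeta> ^ j \<noteq> \<zeta> ^ i" using inj that by (auto dest: inj_onD)
    ultimately show ?thesis by (simp add: mult.commute)
  qed
  have diag: "T $$ (i, i) = T $$ (0, 0)" if "i < p" for i
    using that
  proof (induction i)
    case (Suc i)
    \<comment> \<open>At this entry the left side is T at (Suc i, Suc i) and the right side T at (i,
      i); as Suc i < p, neither index wraps around.\<close>
    have "(T * weyl_v p) $$ (Suc i, i) = (weyl_v p * T) $$ (Suc i, i)" by (simp add: v)
    then show ?case
      using Suc T by (simp add: mult_weyl_v_index[OF T] weyl_v_mult_index[OF T] split: if_splits)
  qed simp
  show ?thesis
  proof (rule eq_matI)
    fix i j assume "i < dim_row (T $$ (0, 0) \<cdot>\<^sub>m 1\<^sub>m p)" "j < dim_col (T $$ (0, 0) \<cdot>\<^sub>m 1\<^sub>m p)"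
    then have ij: "i < p" "j < p" by auto
    show "T $$ (i, j) = (T $$ (0, 0) \<cdot>\<^sub>m 1\<^sub>m p) $$ (i, j)"
      using off[OF ij] diag[OF ij(1)] ij by (cases "i = j") auto
  qed (use T in auto)
qed

theorem theorem5p4:
  fixes p :: nat and \<zeta> :: complex
  assumes "p \<ge> 2"
    and "\<zeta> ^ p = 1" and "\<And>k. 0 < k \<Longrightarrow> k < p \<Longrightarrow> \<zeta> ^ k \<noteq> 1"
  shows "absolute_extreme_point 2 (matrix_range p [weyl_u p \<zeta>, weyl_v p]) p
           [weyl_u p \<zeta>, weyl_v p]"
proof (rule absolute_extreme_point_irreducible_unitaries)
  have \<zeta>: "cmod \<zeta> = 1"
    using assms(1) power_eq_1_iff[OF assms(2)] by simp
  show u: "unitary p U" if "U \<in> set [weyl_u p \<zeta>, weyl_v p]" for U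
    using that unitary_weyl_u[OF \<zeta>] unitary_weyl_v by auto
  then show "[weyl_u p \<zeta>, weyl_v p] \<in> mtuples 2 p"
    by (simp add: mtuples_def unitary_def)
  \<comment> \<open>Cancelling the nonzero power with exponent i reduces this to primitivity at the
    exponent j - i, which lies strictly between 0 and p.\<close>
  have "\<zeta> ^ i \<noteq> \<zeta> ^ j" if "i < j" "j < p" for i j
  proof
    assume "\<zeta> ^ i = \<zeta> ^ j"
    then have "\<zeta> ^ i * \<zeta> ^ (j - i) = \<zeta> ^ i * 1" using that power_add[of \<zeta> i "j - i"] by simp
    moreover have "\<zeta> \<noteq> 0" using \<zeta> by auto
    ultimately show False using assms(3)[of "j - i"] that by simp
  qed
  then have "inj_on (\<lambda>i. \<zeta> ^ i) {..<p}"
    by (intro inj_onI) (metis lessThan_iff linorder_neqE_nat)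
  from weyl_commutant[OF this] show "\<exists>c. T = c \<cdot>\<^sub>m 1\<^sub>m p" if "T \<in> carrier_mat p p"
    "\<And>U. U \<in> set [weyl_u p \<zeta>, weyl_v p] \<Longrightarrow> T * U = U * T" for T
    using that by (metis list.set_intros)
qed (use assms in simp)

end
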